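(* Let $\mathcal{X}$ be a Polish space and $P(\tau,x,t,\cdot)$, $\tau\le t$ in $\mathbb{R}$, $x\in\mathcal{X}$, the transition probabilities of an inhomogeneous Markov process on $\mathcal{X}$. Let $V:\mathcal{X}\to[0,\infty]$ be a Borel measurable function such that: (A1) $\{x:V(x)<\infty\}$ is nonempty, and for any $t\in\mathbb{R}^+$ there exist $0<\gamma=\gamma(t)<1$ and $C>0$ such that for any $x\in\mathcal{X}$ and $s\in\mathbb{R}$, $\int_{\mathcal{X}}V(y)P(s-t,x,s,dy)\le\gamma V(x)+C$; (A2) for any $R>0$ there exist $t_0=t_0(R)\in\mathbb{R}^+$ and $0<\delta=\delta(R)<1$ such that for any $t\in\mathbb{R}$, $$\sup_{(x,y):\,V(x)+V(y)\le R}\|P(t-t_0,x,t,\cdot)-P(t-t_0,y,t,\cdot)\|_{TV}\le 2(1-\delta).$$ Then, for the unique invariant measure family $\{\mu_t\}_{t\in\mathbb{R}}$ for $P$ satisfying $\int_{\mathcal{X}}V\,d\mu_t<+\infty$ for all $t\in\mathbb{R}$, the following hold: (i) there exist constants $0<\alpha<1$ and $M>0$ such that $$\Big\|\int_{\mathcal{X}}\varphi(y)P(\tau-t,\cdot,\tau,dy)-\int_{\mathcal{X}}\varphi(y)\mu_\tau(dy)\Big\|\le M\alpha^{t}\Big\|\varphi-\int_{\mathcal{X}}\varphi(y)\mu_\tau(dy)\Big\|$$ for any $\tau\in\mathbb{R}$, $t\ge 0$ and any bounded measurable function $\varphi:\mathcal{X}\to\mathbb{R}$; (ii) there exist constants $0<\alpha<1$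 and $\tilde{M}>0$ such that $$\|P(\tau-t,x,\tau,\cdot)-\mu_\tau\|_{TV}\le\tilde{M}\alpha^{t}(1+V(x))$$ for any $\tau\in\mathbb{R}$, $t\ge 0$ and $x\in\mathcal{X}$.
   Context: $\mathbb{R}^+=(0,\infty)$. $\mathcal{X}$ carries its Borel $\sigma$-field. The transition probabilities $P(\tau,x,t,\cdot)$ are Borel probability measures, measurable in $x$, with $P(t,x,t,\cdot)=\delta_x$, satisfying the Chapman–Kolmogorov equations $P(s,x,t,A)=\int_{\mathcal{X}}P(\tau,y,t,A)P(s,x,\tau,dy)$ for $s\le\tau\le t$. Transition operators: $P^{\ast}_{\tau,t}\nu(A)=\int_{\mathcal{X}}P(\tau,x,t,A)\,\nu(dx)$ for probability measures $\nu$. Invariant measure family for $P$: a family $\{\mu_t\}_{t\in\mathbb{R}}$ of Borel probability measures on $\mathcal{X}$ such that $P^{\ast}_{s,t}\mu_s=\mu_t$ for every $s\in\mathbb{R}$ and $t\ge s$. Total variation norm of a finite signed measure $\mu$: $\|\mu\|_{TV}=\sup\{|\int\phi\,d\mu|:\phi\text{ measurable},\ \sup|\phi|\le 1\}$ (so the difference of two probability measures has norm at most $2$). Weighted supremum norm with respect to $V$: $\|\varphi\|:=\sup_{x\in\mathcal{X}}\frac{|\varphi(x)|}{1+V(x)}$ (quotients with infinite denominator are $0$).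
   Formalization: In (A1) the constant C is taken independent of t (with C depending on t, (i) can fail), and the invariant family is shown unique only among those with sup over t of ∫V dμ_t finite, since finiteness for each t does not give uniqueness. *)

theory Defs
  imports "HOL-Probability.Probability"
begin

text \<open>
  \<open>P \<tau> x t\<close> is the law at time \<open>t\<close> of the process started in \<open>x\<close> at time \<open>\<tau>\<close>; its values for
  \<open>t < \<tau>\<close> are irrelevant. Membership in \<open>borel \<rightarrow>\<^sub>M prob_algebra borel\<close> says that every \<open>P \<tau> x t\<close>
  is a Borel probability measure and that \<open>x \<mapsto> P \<tau> x t A\<close> is measurable for each Borel set \<open>A\<close>.
\<close>

definition transition_probabilities ::
  "(real \<Rightarrow> 'a::polish_space \<Rightarrow> real \<Rightarrow> 'a measure) \<Rightarrow> bool" where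
  "transition_probabilities P \<longleftrightarrow>
     (\<forall>\<tau> t. \<tau> \<le> t \<longrightarrow> (\<lambda>x. P \<tau> x t) \<in> borel \<rightarrow>\<^sub>M prob_algebra borel) \<and>
     (\<forall>t x. P t x t = return borel x) \<and>
     (\<forall>s \<tau> t x. \<forall>A\<in>sets borel. s \<le> \<tau> \<and> \<tau> \<le> t \<longrightarrow>
        emeasure (P s x t) A = (\<integral>\<^sup>+ y. emeasure (P \<tau> y t) A \<partial>P s x \<tau>))"

definition transition_operator ::
  "(real \<Rightarrow> 'a::polish_space \<Rightarrow> real \<Rightarrow> 'a measure) \<Rightarrow> real \<Rightarrow> real \<Rightarrow> 'a measure \<Rightarrow> 'a measure" where
  "transition_operator P \<tau> t \<nu> = \<nu> \<bind> (\<lambda>x. P \<tau> x t)"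

lemma emeasure_transition_operator:
  assumes "transition_probabilities P" and "\<tau> \<le> t"
    and "\<nu> \<in> space (prob_algebra borel)" and "A \<in> sets borel"
  shows "emeasure (transition_operator P \<tau> t \<nu>) A = (\<integral>\<^sup>+ x. emeasure (P \<tau> x t) A \<partial>\<nu>)"
  using assms unfolding transition_operator_def transition_probabilities_def
  by (intro emeasure_bind_prob_algebra[where N = borel and L = borel]) auto

text \<open>
  Finiteness of \<open>\<integral>\<^sup>+ x. V x \<partial>\<mu> t\<close> for each single \<open>t\<close> does not determine an invariant measure
  family under the conditions below: for the Ornstein--Uhlenbeck process \<open>dX = - X dt + dW\<close> and
  \<open>V x = \<bar>x\<bar>\<close>, the normal laws with mean \<open>c * exp (- t)\<close> and variance \<open>1/2\<close> form such a family for
  every real \<open>c\<close>. Uniqueness holds among the families with bounded \<open>\<integral>\<^sup>+ x. V x \<partial>\<mu> t\<close> (here \<open>c = 0\<close>).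
\<close>

definition invariant_measure_family ::
  "(real \<Rightarrow> 'a::polish_space \<Rightarrow> real \<Rightarrow> 'a measure) \<Rightarrow> (real \<Rightarrow> 'a measure) \<Rightarrow> bool" where
  "invariant_measure_family P \<mu> \<longleftrightarrow>
     (\<forall>t. \<mu> t \<in> space (prob_algebra borel)) \<and>
     (\<forall>s t. s \<le> t \<longrightarrow> transition_operator P s t (\<mu> s) = \<mu> t)"

text \<open>
  The total variation norm of the signed measure \<open>\<mu> - \<nu>\<close>, for finite Borel measures \<open>\<mu>\<close> and \<open>\<nu>\<close>.
  The normalisation is the one giving norm \<open>2\<close> to the difference of mutually singular
  probability measures.
\<close>

definition tv_norm_diff :: "'a::topological_space measure \<Rightarrow> 'a measure \<Rightarrow> ennreal" where
  "tv_norm_diff \<mu> \<nu> =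
     (SUP \<phi>\<in>{\<phi> \<in> borel_measurable borel. \<forall>x. \<bar>\<phi> x\<bar> \<le> 1}.
        ennreal \<bar>(\<integral>x. \<phi> x \<partial>\<mu>) - (\<integral>x. \<phi> x \<partial>\<nu>)\<bar>)"

text \<open>Division in \<^typ>\<open>ennreal\<close> gives \<open>0\<close> wherever \<open>V x = \<infinity>\<close>.\<close>

definition weighted_sup_norm :: "('a \<Rightarrow> ennreal) \<Rightarrow> ('a \<Rightarrow> real) \<Rightarrow> ennreal" where
  "weighted_sup_norm V \<phi> = (SUP x. ennreal \<bar>\<phi> x\<bar> / (1 + V x))"

text \<open>
  Only \<open>\<gamma>\<close> depends on \<open>t\<close>. If \<open>C\<close> could depend on \<open>t\<close>, then \<open>C\<close> might blow up as \<open>t \<rightarrow> 0\<close>, and no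
  bound on the transition operators in the weighted norm could hold uniformly for small \<open>t\<close>.
\<close>

definition lyapunov_condition ::
  "(real \<Rightarrow> 'a::polish_space \<Rightarrow> real \<Rightarrow> 'a measure) \<Rightarrow> ('a \<Rightarrow> ennreal) \<Rightarrow> bool" where
  "lyapunov_condition P V \<longleftrightarrow>
     {x. V x < \<infinity>} \<noteq> {} \<and>
     (\<exists>C::real. C > 0 \<and>
       (\<forall>t::real. t > 0 \<longrightarrow>
         (\<exists>\<gamma>::real. 0 < \<gamma> \<and> \<gamma> < 1 \<and>
           (\<forall>x s. (\<integral>\<^sup>+ y. V y \<partial>P (s - t) x s) \<le> ennreal \<gamma> * V x + ennreal C))))"

definition local_doeblin_condition ::
  "(real \<Rightarrow> 'a::polish_space \<Rightarrow> real \<Rightarrow> 'a measure) \<Rightarrow> ('a \<Rightarrow> ennreal) \<Rightarrow> bool" where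
  "local_doeblin_condition P V \<longleftrightarrow>
     (\<forall>R::real. R > 0 \<longrightarrow>
       (\<exists>t\<^sub>0 \<delta>::real. t\<^sub>0 > 0 \<and> 0 < \<delta> \<and> \<delta> < 1 \<and>
         (\<forall>t::real. (SUP (x, y)\<in>{(x, y). V x + V y \<le> ennreal R}.
              tv_norm_diff (P (t - t\<^sub>0) x t) (P (t - t\<^sub>0) y t)) \<le> ennreal (2 * (1 - \<delta>)))))"

end

theory Submission
  imports Defs
begin

text \<open>
  This is Harris' theorem for an inhomogeneous process. Call
  \<open>2 + \<beta> * (V x + V y)\<close> the weighted distance of two points with finite \<open>V\<close>, and measure the oscillation
  of a function by its Lipschitz constant for this distance. The Lyapunov constant \<open>C\<close> does not depend
  on the elapsed time, so iterating the bound for time \<open>1\<close> gives \<open>P V \<le> V / 4 + K\<close> over all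
  sufficiently long times, with \<open>K\<close> known before the Doeblin condition is applied at level \<open>R = 4 * K\<close>.
  Since total variation decreases along the evolution, the Doeblin bound at the time \<open>t\<^sub>0(R)\<close> persists
  for long times, and both bounds hold over a common time \<open>T\<close>. With \<open>\<beta> = \<delta> / (2 * K)\<close> the evolution
  over time \<open>T\<close> contracts oscillations by \<open>1 - \<delta> / 8\<close>: if \<open>V x + V y\<close> is large the Lyapunov bound
  gains, otherwise the Doeblin bound does.

  Hence the laws \<open>P (\<tau> - t) x\<^sub>0 \<tau>\<close> are Cauchy in total variation as \<open>t\<close> tends to infinity, for a point
  \<open>x\<^sub>0\<close> with finite \<open>V\<close>. Their limits form the invariant family, and comparing \<open>P (\<tau> - t) x \<tau>\<close> with
  the image of \<open>\<mu> (\<tau> - t)\<close> by the same contraction gives both rates as well as uniqueness.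
\<close>

section \<open>Probability measures close on sets\<close>

lemma prob_algebraD:
  assumes "p \<in> space (prob_algebra borel)"
  shows "prob_space p" "sets p = sets borel" "space p = UNIV"
  using assms by (auto simp: space_prob_algebra dest: sets_eq_imp_space_eq)

lemma integrable_bounded_borel:
  fixes f :: "'a::topological_space \<Rightarrow> real"
  assumes p: "p \<in> space (prob_algebra borel)"
    and f: "f \<in> borel_measurable borel" "bounded (range f)"
  shows "integrable p f"
proof -
  interpret prob_space p using prob_algebraD(1)[OF p] .
  obtain B where "\<And>x. norm (f x) \<le> B"
    using f(2) by (auto simp: bounded_iff)
  then show ?thesis
    using f(1) by (intro integrable_const_bound[where B = B])
      (auto cong: measurable_cong_sets simp: prob_algebraD(2)[OF p])
qed

text \<open>The majorant is affine in \<open>v\<close> because this is what the weighted distance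
  becomes when one of its two points is fixed; \<open>B = 0\<close> covers uniformly bounded
  functions.\<close>

lemma abs_integral_diff_const_le:
  fixes f v :: "'a \<Rightarrow> real"
  assumes "prob_space p" and f: "integrable p f" and v: "integrable p v"
    and le: "AE x in p. \<bar>f x - c\<bar> \<le> A + B * v x"
  shows "\<bar>(\<integral>x. f x \<partial>p) - c\<bar> \<le> A + B * (\<integral>x. v x \<partial>p)"
proof -
  interpret prob_space p by fact
  have "\<bar>(\<integral>x. f x \<partial>p) - c\<bar> = \<bar>\<integral>x. f x - c \<partial>p\<bar>"
    using f by (simp add: prob_space)
  also have "\<dots> \<le> (\<integral>x. \<bar>f x - c\<bar> \<partial>p)"
    by (rule integral_abs_bound)
  also have "\<dots> \<le> (\<integral>x. A + B * v x \<partial>p)"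
    using f v le by (intro integral_mono_AE) auto
  also have "\<dots> = A + B * (\<integral>x. v x \<partial>p)"
    using v by (simp add: prob_space)
  finally show ?thesis .
qed

text \<open>Passage from the extended-valued \<open>V\<close> to real integrals: a finite moment
  makes \<open>V = \<infinity>\<close> a null event, so the value \<open>0\<close> that
  \<open>enn2real\<close> assigns there does no harm.\<close>

lemma enn2real_of_finite_integral:
  fixes V :: "'a::topological_space \<Rightarrow> ennreal"
  assumes p: "p \<in> space (prob_algebra borel)" and V: "V \<in> borel_measurable borel"
    and le: "(\<integral>\<^sup>+x. V x \<partial>p) \<le> ennreal a" and a: "a \<ge> 0"
  shows "AE x in p. V x < \<infinity>"
    and "integrable p (\<lambda>x. enn2real (V x))"
    and "(\<integral>x. enn2real (V x) \<partial>p) \<le> a"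
proof -
  note [measurable_cong] = prob_algebraD(2)[OF p]
  note [measurable] = V
  have *: "(\<integral>\<^sup>+x. V x \<partial>p) \<noteq> \<infinity>"
    using le by (auto simp: top_unique)
  then show AE: "AE x in p. V x < \<infinity>"
    using nn_integral_PInf_AE[of V p] by (auto simp: less_top)
  have eq: "(\<integral>\<^sup>+x. ennreal (enn2real (V x)) \<partial>p) = (\<integral>\<^sup>+x. V x \<partial>p)"
    using AE by (intro nn_integral_cong_AE) auto
  show "integrable p (\<lambda>x. enn2real (V x))"
    using * by (intro integrableI_nonneg) (auto simp: eq less_top)
  show "(\<integral>x. enn2real (V x) \<partial>p) \<le> a"
    using le a by (subst integral_eq_nn_integral) (auto simp: eq enn2real_leI)
qed

text \<open>The sum counts how many of the levels \<open>1/n, ..., n/n\<close> are reached by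
  \<open>u\<close>. The count is the integer part of \<open>n * u\<close>, so its fraction of
  \<open>n\<close> misses \<open>u\<close> by at most \<open>1/n\<close>.\<close>

lemma step_function_approx:
  fixes u :: real
  assumes "0 \<le> u" "u \<le> 1" "n > 0"
  shows "\<bar>u - (\<Sum>j=1..n. indicator {r. real j / real n \<le> r} u) / real n\<bar> \<le> 1 / real n"
proof -
  define m where "m = nat \<lfloor>real n * u\<rfloor>"
  have m: "real m \<le> real n * u" "real n * u < real m + 1"
    using assms unfolding m_def by (auto simp: of_nat_nat)
  have "real n * u \<le> real n" using assms by (simp add: mult_left_le)
  then have mn: "m \<le> n" using m(1) by linarith
  have "real j / real n \<le> u \<longleftrightarrow> j \<le> m" for j
  proof -
    have "real j / real n \<le> u \<longleftrightarrow> real j \<le> real n * u"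
      using assms by (simp add: field_simps)
    also have "\<dots> \<longleftrightarrow> j \<le> m" using m by linarith
    finally show ?thesis .
  qed
  then have "(\<Sum>j=1..n. indicator {r. real j / real n \<le> r} u) = (\<Sum>j=1..n. if j \<le> m then 1 else 0 :: real)"
    by (intro sum.cong) (auto simp: indicator_def)
  also have "\<dots> = real (card {j\<in>{1..n}. j \<le> m})"
    by (simp add: sum.If_cases Int_def)
  also have "{j\<in>{1..n}. j \<le> m} = {1..m}" using mn by auto
  finally have eq: "(\<Sum>j=1..n. indicator {r. real j / real n \<le> r} u) = real m" by simp
  have "\<bar>u - real m / real n\<bar> = \<bar>real n * u - real m\<bar> / real n"
    using assms by (simp add: field_simps abs_if)
  also have "\<dots> \<le> 1 / real n"
    using m by (intro divide_right_mono) auto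
  finally show ?thesis by (simp only: eq)
qed

text \<open>Layer cake: the integral of a function with values in [0,1] is, up to
  \<open>1/n\<close>, the average measure of \<open>n\<close> superlevel sets, and averaging
  preserves the bound \<open>c\<close>. The factor \<open>2\<close> undoes the rescaling of
  \<open>f\<close> to \<open>u\<close>.\<close>

lemma abs_integral_diff_le_of_sets:
  fixes f :: "'a::topological_space \<Rightarrow> real"
  assumes p: "p \<in> space (prob_algebra borel)" and q: "q \<in> space (prob_algebra borel)"
    and c: "\<And>A. A \<in> sets borel \<Longrightarrow> \<bar>measure p A - measure q A\<bar> \<le> c"
    and f: "f \<in> borel_measurable borel" and bnd: "\<And>x. \<bar>f x\<bar> \<le> 1"
  shows "\<bar>(\<integral>x. f x \<partial>p) - (\<integral>x. f x \<partial>q)\<bar> \<le> 2 * c"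
proof -
  define u where "u x = (f x + 1) / 2" for x
  have u[measurable]: "u \<in> borel_measurable borel" using f unfolding u_def by measurable
  have u01: "0 \<le> u x" "u x \<le> 1" for x using bnd[of x] by (auto simp: u_def)
  define A where "A n j = {x. real j / real n \<le> u x}" for n j :: nat
  have A[measurable]: "A n j \<in> sets borel" for n j
    unfolding A_def by measurable
  define g where "g n x = (\<Sum>j=1..n. indicator (A n j) x) / real n" for n x
  have appr: "\<bar>(\<integral>x. u x \<partial>r) - (\<Sum>j=1..n. measure r (A n j)) / real n\<bar> \<le> 1 / real n"
    if r: "r \<in> space (prob_algebra borel)" and n: "n > 0" for r n
  proof -
    interpret r: prob_space r using prob_algebraD(1)[OF r] .
    note [measurable_cong] = prob_algebraD(2)[OF r]
    have iu: "integrable r u" using u01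
      by (intro r.integrable_const_bound[where B = 1]) auto
    have ig: "integrable r (indicator (A n j) :: _ \<Rightarrow> real)" for j
      using A[of n j] by (simp add: prob_algebraD(2)[OF r] r.emeasure_finite less_top[symmetric])
    have gi: "(\<integral>x. g n x \<partial>r) = (\<Sum>j=1..n. measure r (A n j)) / real n"
      unfolding g_def using ig by (simp add: prob_algebraD[OF r])
    have ign: "integrable r (g n)"
      unfolding g_def using ig by (intro integrable_divide integrable_sum) auto
    have "\<bar>u x - g n x\<bar> \<le> 1 / real n" for x
      using step_function_approx[OF u01(1,2) n, of x] unfolding g_def A_def by (simp add: indicator_def)
    then have "\<bar>(\<integral>x. u x - g n x \<partial>r) - 0\<bar> \<le> 1 / real n + 0 * (\<integral>x. 0 \<partial>r)"
      using iu ign by (intro abs_integral_diff_const_le[OF r.prob_space_axioms]) auto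
    then show ?thesis using iu ign by (simp add: gi)
  qed
  have bound: "\<bar>(\<integral>x. u x \<partial>p) - (\<integral>x. u x \<partial>q)\<bar> \<le> c + 2 * (1 / real n)" if n: "n > 0" for n
  proof -
    have "\<bar>(\<Sum>j=1..n. measure p (A n j)) - (\<Sum>j=1..n. measure q (A n j))\<bar> \<le> real n * c"
      using sum_norm_le[of "{1..n}" "\<lambda>j. measure p (A n j) - measure q (A n j)" "\<lambda>_. c"] c[OF A]
      by (simp add: sum_subtractf)
    then have "\<bar>(\<Sum>j=1..n. measure p (A n j)) / real n - (\<Sum>j=1..n. measure q (A n j)) / real n\<bar> \<le> c"
      using n by (simp add: diff_divide_distrib[symmetric] field_simps)
    then show ?thesis using appr[OF p n] appr[OF q n] by linarith
  qed
  have "(\<lambda>n. c + 2 * (1 / real n)) \<longlonglongrightarrow> c + 2 * 0"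
    by (intro tendsto_intros lim_1_over_n)
  then have "\<bar>(\<integral>x. u x \<partial>p) - (\<integral>x. u x \<partial>q)\<bar> \<le> c"
    using bound by (intro LIMSEQ_le_const[where X = "\<lambda>n. c + 2 * (1 / real n)"]) (auto intro!: exI[of _ 1])
  moreover have "(\<integral>x. u x \<partial>r) = ((\<integral>x. f x \<partial>r) + 1) / 2" if r: "r \<in> space (prob_algebra borel)" for r
  proof -
    interpret r: prob_space r using prob_algebraD(1)[OF r] .
    have "bounded (range f)" using bnd by (auto simp: bounded_iff)
    then show ?thesis
      using integrable_bounded_borel[OF r f] unfolding u_def by (simp add: r.prob_space)
  qed
  ultimately show ?thesis using p q by (simp add: abs_if field_simps split: if_splits)
qed

text \<open>The numerical limits exist set by set; uniformity over the sets then carries countable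
  additivity to the limit.\<close>

lemma uniform_Cauchy_imp_setwise_limit:
  fixes m :: "nat \<Rightarrow> 'a measure"
  assumes m: "\<And>n. m n \<in> space (prob_algebra N)"
    and Cauchy: "\<And>\<epsilon>. \<epsilon> > 0 \<Longrightarrow> \<exists>n\<^sub>0. \<forall>n\<ge>n\<^sub>0. \<forall>k\<ge>n\<^sub>0. \<forall>A\<in>sets N. \<bar>measure (m n) A - measure (m k) A\<bar> < \<epsilon>"
  obtains \<mu> where "\<mu> \<in> space (prob_algebra N)"
    and "\<And>A. A \<in> sets N \<Longrightarrow> (\<lambda>n. measure (m n) A) \<longlonglongrightarrow> measure \<mu> A"
proof -
  have prob: "prob_space (m n)" and sets: "sets (m n) = sets N" and space: "space (m n) = space N" for n
    using m[of n] by (auto simp: space_prob_algebra dest: sets_eq_imp_space_eq)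
  define f where "f A = lim (\<lambda>n. measure (m n) A)" for A
  have lim: "(\<lambda>n. measure (m n) A) \<longlonglongrightarrow> f A" if "A \<in> sets N" for A
  proof -
    have "Cauchy (\<lambda>n. measure (m n) A)"
      unfolding Cauchy_def dist_real_def using Cauchy that by meson
    then show ?thesis
      unfolding f_def by (simp add: Cauchy_convergent_iff convergent_LIMSEQ_iff)
  qed
  have f0: "f A \<ge> 0" if "A \<in> sets N" for A
    using lim[OF that] by (rule LIMSEQ_le_const) auto
  \<comment> \<open>A single \<open>m n\<close> dominates the limit up to \<open>\<epsilon>\<close>
    on all sets at once, so its continuity along decreasing sequences transfers to
    \<open>f\<close>.\<close>
  have uni: "\<exists>n. \<forall>A\<in>sets N. f A \<le> measure (m n) A + \<epsilon>" if "\<epsilon> > 0" for \<epsilon>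
  proof -
    obtain n where n: "\<forall>k\<ge>n. \<forall>A\<in>sets N. \<bar>measure (m k) A - measure (m n) A\<bar> < \<epsilon>"
      using Cauchy[OF \<open>\<epsilon> > 0\<close>] by blast
    have "f A \<le> measure (m n) A + \<epsilon>" if A: "A \<in> sets N" for A
    proof (rule LIMSEQ_le_const2[OF lim[OF A]])
      show "\<exists>k. \<forall>i\<ge>k. measure (m i) A \<le> measure (m n) A + \<epsilon>"
        using n A by (intro exI[of _ n] allI impI) (smt (verit, best))
    qed
    then show ?thesis by blast
  qed
  have pos: "positive (sets N) (\<lambda>A. ennreal (f A))"
  proof -
    have "(\<lambda>n. measure (m n) {}) \<longlonglongrightarrow> 0" by simp
    then have "f {} = 0" using lim[of "{}"] LIMSEQ_unique by blast
    then show ?thesis by (simp add: positive_def)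
  qed
  have add: "additive (sets N) (\<lambda>A. ennreal (f A))"
    unfolding additive_def
  proof (intro ballI impI)
    fix A B assume AB: "A \<in> sets N" "B \<in> sets N" "A \<inter> B = {}"
    have "(\<lambda>n. measure (m n) (A \<union> B)) = (\<lambda>n. measure (m n) A + measure (m n) B)"
      using AB sets prob by (auto intro!: finite_measure.finite_measure_Union prob_space.finite_measure)
    then have "f (A \<union> B) = f A + f B"
      using lim[of "A \<union> B"] tendsto_add[OF lim[OF AB(1)] lim[OF AB(2)]] AB LIMSEQ_unique by auto
    then show "ennreal (f (A \<union> B)) = ennreal (f A) + ennreal (f B)"
      using f0 AB by simp
  qed
  have ca: "countably_additive (sets N) (\<lambda>A. ennreal (f A))"
  proof (rule sets.empty_continuous_imp_countably_additive[OF pos add])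
    fix A :: "nat \<Rightarrow> 'a set" assume A: "range A \<subseteq> sets N" "decseq A" "(\<Inter>i. A i) = {}"
    have "(\<lambda>i. f (A i)) \<longlonglongrightarrow> 0"
    proof (rule LIMSEQ_I)
      fix \<epsilon> :: real assume e: "\<epsilon> > 0"
      then obtain n where n: "\<forall>A\<in>sets N. f A \<le> measure (m n) A + \<epsilon> / 2"
        using uni[of "\<epsilon> / 2"] by auto
      have "(\<lambda>i. measure (m n) (A i)) \<longlonglongrightarrow> measure (m n) (\<Inter>i. A i)"
        using A sets prob by (intro finite_measure.finite_Lim_measure_decseq prob_space.finite_measure) auto
      then have "(\<lambda>i. measure (m n) (A i)) \<longlonglongrightarrow> 0" using A by simp
      then obtain i0 where i0: "\<forall>i\<ge>i0. norm (measure (m n) (A i) - 0) < \<epsilon> / 2"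
        using e by (metis LIMSEQ_D half_gt_zero)
      have "norm (f (A i) - 0) < \<epsilon>" if "i \<ge> i0" for i
      proof -
        have Ai: "A i \<in> sets N" using A by auto
        have "measure (m n) (A i) < \<epsilon> / 2" using i0 that by auto
        then have "f (A i) < \<epsilon>" using n Ai by fastforce
        then show ?thesis using f0[OF Ai] by simp
      qed
      then show "\<exists>i0. \<forall>i\<ge>i0. norm (f (A i) - 0) < \<epsilon>" by blast
    qed
    then show "(\<lambda>i. ennreal (f (A i))) \<longlonglongrightarrow> 0"
      using tendsto_ennrealI by fastforce
  qed simp
  define \<mu> where "\<mu> = measure_of (space N) (sets N) (\<lambda>A. ennreal (f A))"
  have em: "emeasure \<mu> A = ennreal (f A)" if "A \<in> sets N" for A
    using emeasure_measure_of_sigma[OF sets.sigma_algebra_axioms pos ca that] by (simp add: \<mu>_def)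
  have s: "sets \<mu> = sets N" "space \<mu> = space N" by (simp_all add: \<mu>_def)
  have "(\<lambda>n. measure (m n) (space N)) = (\<lambda>n. 1)"
    using prob space prob_space.prob_space by metis
  then have "f (space N) = 1" using lim[of "space N"] by (simp add: LIMSEQ_const_iff)
  then have "prob_space \<mu>" by (intro prob_spaceI) (simp add: s em)
  show thesis
  proof
    show "\<mu> \<in> space (prob_algebra N)" using \<open>prob_space \<mu>\<close> s by (simp add: space_prob_algebra)
    show "(\<lambda>n. measure (m n) A) \<longlonglongrightarrow> measure \<mu> A" if "A \<in> sets N" for A
      using lim[OF that] f0[OF that] by (simp add: measure_def em[OF that])
  qed
qed

lemma prob_algebra_eqI:
  assumes "p \<in> space (prob_algebra N)" "q \<in> space (prob_algebra N)"
    and eq: "\<And>A. A \<in> sets N \<Longrightarrow> measure p A = measure q A"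
  shows "p = q"
proof (rule measure_eqI)
  have p: "sets p = sets N" "finite_measure p" and q: "sets q = sets N" "finite_measure q"
    using assms by (auto simp: space_prob_algebra prob_space.finite_measure)
  show "sets p = sets q" using p q by simp
  fix A assume "A \<in> sets p"
  then show "emeasure p A = emeasure q A"
    using eq[of A] p q by (simp add: finite_measure.emeasure_eq_measure)
qed

lemma eq_if_diff_le_geometric:
  fixes x y \<alpha> C :: real
  assumes "0 < \<alpha>" "\<alpha> < 1" and le: "\<And>n. \<bar>x - y\<bar> \<le> C * \<alpha> ^ n"
  shows "x = y"
proof -
  have "(\<lambda>n. C * \<alpha> ^ n) \<longlonglongrightarrow> C * 0"
    using assms by (intro tendsto_intros LIMSEQ_power_zero) auto
  then have "\<bar>x - y\<bar> \<le> C * 0"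
    using le by (intro LIMSEQ_le_const) auto
  then show ?thesis by simp
qed

section \<open>Weighted oscillation and the contraction step\<close>

text \<open>Points with \<open>V = \<infinity>\<close> are left out because \<open>enn2real\<close>
  sends \<infinity> to \<open>0\<close> and would make them look close to everything.\<close>

definition weighted_osc_le :: "('a \<Rightarrow> ennreal) \<Rightarrow> real \<Rightarrow> real \<Rightarrow> ('a \<Rightarrow> real) \<Rightarrow> bool" where
  "weighted_osc_le V \<beta> L f \<longleftrightarrow> (\<forall>x y. V x < \<infinity> \<longrightarrow> V y < \<infinity> \<longrightarrow>
     \<bar>f x - f y\<bar> \<le> L * (2 + \<beta> * (enn2real (V x) + enn2real (V y))))"

text \<open>The pointwise bound is integrated against the independent coupling of \<open>p\<close>
  and \<open>q\<close>, one variable at a time: first \<open>x\<close> under \<open>p\<close> with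
  \<open>y\<close> fixed, then \<open>y\<close> under \<open>q\<close>.\<close>

lemma weighted_osc_integral_diff:
  fixes V :: "'a::topological_space \<Rightarrow> ennreal"
  assumes p: "p \<in> space (prob_algebra borel)" and q: "q \<in> space (prob_algebra borel)"
    and V: "V \<in> borel_measurable borel"
    and f: "f \<in> borel_measurable borel" "bounded (range f)"
    and osc: "weighted_osc_le V \<beta> L f" and "\<beta> \<ge> 0" "L \<ge> 0"
    and a: "(\<integral>\<^sup>+x. V x \<partial>p) \<le> ennreal a" "a \<ge> 0"
    and b: "(\<integral>\<^sup>+x. V x \<partial>q) \<le> ennreal b" "b \<ge> 0"
  shows "\<bar>(\<integral>x. f x \<partial>p) - (\<integral>x. f x \<partial>q)\<bar> \<le> L * (2 + \<beta> * (a + b))"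
proof -
  let ?v = "\<lambda>x. enn2real (V x)"
  note P = enn2real_of_finite_integral[OF p V a] and Q = enn2real_of_finite_integral[OF q V b]
  have L\<beta>: "L * \<beta> \<ge> 0" using assms by simp
  have 1: "\<bar>(\<integral>x. f x \<partial>p) - f y\<bar> \<le> L * (2 + \<beta> * (a + ?v y))" if "V y < \<infinity>" for y
  proof -
    have "AE x in p. \<bar>f x - f y\<bar> \<le> L * (2 + \<beta> * ?v y) + (L * \<beta>) * ?v x"
      using P(1)
    proof eventually_elim
      case (elim x)
      then show ?case
        using osc that by (force simp: weighted_osc_le_def algebra_simps)
    qed
    from abs_integral_diff_const_le[OF prob_algebraD(1)[OF p] integrable_bounded_borel[OF p f] P(2) this]
    show ?thesis
      using mult_left_mono[OF P(3) L\<beta>] by (simp add: algebra_simps)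
  qed
  have "AE y in q. \<bar>f y - (\<integral>x. f x \<partial>p)\<bar> \<le> L * (2 + \<beta> * a) + (L * \<beta>) * ?v y"
    using Q(1)
  proof eventually_elim
    case (elim y)
    then show ?case
      using 1[of y] by (simp add: algebra_simps abs_minus_commute)
  qed
  from abs_integral_diff_const_le[OF prob_algebraD(1)[OF q] integrable_bounded_borel[OF q f] Q(2) this]
  show ?thesis
    using mult_left_mono[OF Q(3) L\<beta>] by (simp add: algebra_simps abs_minus_commute)
qed

lemma abs_integral_diff_le_tv_norm_diff:
  assumes tv: "tv_norm_diff p q \<le> ennreal c" and "c \<ge> 0"
    and f: "f \<in> borel_measurable borel" and bnd: "\<And>x. \<bar>f x\<bar> \<le> L" and "L \<ge> 0"
  shows "\<bar>(\<integral>x. f x \<partial>p) - (\<integral>x. f x \<partial>q)\<bar> \<le> L * c"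
proof (cases "L = 0")
  case True
  then have "f = (\<lambda>_. 0)" using bnd by auto
  then show ?thesis using True by simp
next
  case False
  with \<open>L \<ge> 0\<close> have L: "L > 0" by simp
  have "(\<lambda>x. f x / L) \<in> {\<phi> \<in> borel_measurable borel. \<forall>x. \<bar>\<phi> x\<bar> \<le> 1}"
    using f bnd L by (auto simp: field_simps)
  then have "ennreal \<bar>(\<integral>x. f x / L \<partial>p) - (\<integral>x. f x / L \<partial>q)\<bar> \<le> tv_norm_diff p q"
    unfolding tv_norm_diff_def by (rule SUP_upper)
  also note tv
  finally have "\<bar>(\<integral>x. f x \<partial>p) / L - (\<integral>x. f x \<partial>q) / L\<bar> \<le> c"
    using \<open>c \<ge> 0\<close> by simp
  then show ?thesis
    using L by (simp add: diff_divide_distrib[symmetric] field_simps)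
qed

lemma tv_norm_diff_leI:
  assumes "\<And>f. f \<in> borel_measurable borel \<Longrightarrow> (\<And>x. \<bar>f x\<bar> \<le> 1) \<Longrightarrow>
    \<bar>(\<integral>x. f x \<partial>p) - (\<integral>x. f x \<partial>q)\<bar> \<le> c"
  shows "tv_norm_diff p q \<le> ennreal c"
  unfolding tv_norm_diff_def using assms by (intro SUP_least ennreal_leI) auto

text \<open>With \<open>h x = L * (1 + \<beta> * enn2real (V x))\<close> the hypothesis reads
  \<open>\<bar>f x - f y\<bar> \<le> h x + h y\<close>. Every \<open>f x - h x\<close> then lies
  below every \<open>f y + h y\<close>, and the supremum of the former serves as \<open>c\<close>.
  Weighted oscillation is thus a weighted sup norm modulo constants.\<close>

lemma weighted_osc_le_shift:
  assumes osc: "weighted_osc_le V \<beta> L f" and ne: "{x. V x < \<infinity>} \<noteq> {}"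
  obtains c where "\<And>x. V x < \<infinity> \<Longrightarrow> \<bar>f x - c\<bar> \<le> L * (1 + \<beta> * enn2real (V x))"
proof -
  let ?h = "\<lambda>x. L * (1 + \<beta> * enn2real (V x))"
  let ?F = "{x. V x < \<infinity>}"
  obtain x0 where x0: "V x0 < \<infinity>" using ne by auto
  have le: "f x - ?h x \<le> f y + ?h y" if "V x < \<infinity>" "V y < \<infinity>" for x y
    using osc that unfolding weighted_osc_le_def by (force simp: algebra_simps)
  have bdd: "bdd_above ((\<lambda>x. f x - ?h x) ` ?F)"
    using le[OF _ x0] by (intro bdd_aboveI2) auto
  define c where "c = (SUP x\<in>?F. f x - ?h x)"
  have "f x - ?h x \<le> c" if "V x < \<infinity>" for x
    unfolding c_def using bdd that by (intro cSUP_upper) auto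
  moreover have "c \<le> f y + ?h y" if "V y < \<infinity>" for y
    unfolding c_def using ne le[OF _ that] by (intro cSUP_least) auto
  ultimately show thesis by (intro that[of c]) force
qed

text \<open>\<open>p\<close> and \<open>q\<close> stand for the laws started in two points where
  \<open>V\<close> has the values \<open>a\<close> and \<open>b\<close>. The weight is chosen so
  that \<open>\<beta> * K = \<delta> / 2\<close>: the additive constants of the two Lyapunov bounds
  then cost \<open>\<delta>\<close> together, half of the Doeblin gain
  \<open>2 * \<delta>\<close>.\<close>

lemma harris_contraction:
  fixes V :: "'a::topological_space \<Rightarrow> ennreal"
  assumes p: "p \<in> space (prob_algebra borel)" and q: "q \<in> space (prob_algebra borel)"
    and V: "V \<in> borel_measurable borel" and ne: "{x. V x < \<infinity>} \<noteq> {}"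
    and f: "f \<in> borel_measurable borel" "bounded (range f)"
    and K: "K > 0" and \<delta>: "0 < \<delta>" "\<delta> < 1" and L: "L \<ge> 0"
    and osc: "weighted_osc_le V (\<delta> / (2 * K)) L f"
    and ab: "a \<ge> 0" "b \<ge> 0"
    and Vp: "(\<integral>\<^sup>+x. V x \<partial>p) \<le> ennreal (a / 4 + K)"
    and Vq: "(\<integral>\<^sup>+x. V x \<partial>q) \<le> ennreal (b / 4 + K)"
    and tv: "a + b \<le> 4 * K \<Longrightarrow> tv_norm_diff p q \<le> ennreal (2 * (1 - \<delta>))"
  shows "\<bar>(\<integral>x. f x \<partial>p) - (\<integral>x. f x \<partial>q)\<bar> \<le> (1 - \<delta> / 8) * L * (2 + \<delta> / (2 * K) * (a + b))"
proof -
  define \<beta> where "\<beta> = \<delta> / (2 * K)"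
  have \<beta>: "\<beta> > 0" "\<beta> * K = \<delta> / 2" using K \<delta> by (auto simp: \<beta>_def)
  define z where "z = \<beta> * (a + b)"
  have z0: "z \<ge> 0" using \<beta> ab by (simp add: z_def)
  have nn: "a / 4 + K \<ge> 0" "b / 4 + K \<ge> 0" using ab K by auto
  have goal: ?thesis if "\<bar>(\<integral>x. f x \<partial>p) - (\<integral>x. f x \<partial>q)\<bar> \<le> L * r"
      and "r \<le> (1 - \<delta> / 8) * (2 + z)" for r
    using that(1) mult_left_mono[OF that(2) L] by (simp add: z_def \<beta>_def mult_ac)
  show ?thesis
  proof (cases "a + b \<le> 4 * K")
    \<comment> \<open>Points far apart: \<open>z\<close> is at least
      \<open>4 * \<beta> * K = 2 * \<delta>\<close>, and its reduction to \<open>z / 4\<close>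
      outweighs the added \<open>\<delta>\<close>.\<close>
    case False
    have "\<bar>(\<integral>x. f x \<partial>p) - (\<integral>x. f x \<partial>q)\<bar> \<le> L * (2 + \<beta> * ((a / 4 + K) + (b / 4 + K)))"
      using osc \<beta> L nn Vp Vq by (intro weighted_osc_integral_diff[OF p q V f]) (auto simp: \<beta>_def)
    also have "\<beta> * ((a / 4 + K) + (b / 4 + K)) = z / 4 + \<delta>"
      using \<beta>(2) by (simp add: z_def algebra_simps)
    finally have le: "\<bar>(\<integral>x. f x \<partial>p) - (\<integral>x. f x \<partial>q)\<bar> \<le> L * (2 + (z / 4 + \<delta>))" .
    have "\<beta> * (4 * K) \<le> z" using False \<beta> unfolding z_def by (intro mult_left_mono) auto
    then have "2 * \<delta> \<le> z" using \<beta>(2) by simp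
    \<comment> \<open>The factor \<open>1 - \<delta> / 8\<close> is calibrated here: at
      \<open>z = 2 * \<delta>\<close>, after division by \<open>\<delta>\<close>, the requirement is
      \<open>5/4 \<le> 3/2 - \<delta> / 4\<close>, which is an equality at
      \<open>\<delta> = 1\<close>.\<close>
    then have "(3/4 - \<delta>/8) * (2 * \<delta>) \<le> (3/4 - \<delta>/8) * z"
      using \<delta> by (intro mult_left_mono) auto
    moreover have "(3/4 - \<delta>/8) * (2 * \<delta>) = 3/2 * \<delta> - \<delta> * \<delta> / 4"
      by (simp add: algebra_simps)
    moreover have "\<delta> * \<delta> \<le> \<delta>" using \<delta> by (simp add: mult_left_le)
    ultimately have "5/4 * \<delta> \<le> (3/4 - \<delta>/8) * z" by linarith
    moreover have "(1 - \<delta> / 8) * (2 + z) = 2 + z / 4 + (3/4 - \<delta>/8) * z - \<delta> / 4"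
      by (simp add: algebra_simps)
    ultimately show ?thesis
      by (intro goal[OF le]) linarith
  next
    case True
    obtain c where c: "\<And>x. V x < \<infinity> \<Longrightarrow> \<bar>f x - c\<bar> \<le> L * (1 + \<beta> * enn2real (V x))"
      using weighted_osc_le_shift[OF osc ne] unfolding \<beta>_def by blast
    \<comment> \<open>Truncation of \<open>f - c\<close> at height \<open>L\<close>: the bounded
      part \<open>f1\<close> is a multiple of a total variation test function and gains from the
      Doeblin bound, while the overshoot \<open>f2\<close> is at most \<open>L * \<beta> * V\<close>
      and is controlled by the Lyapunov bound.\<close>
    define f1 where "f1 x = max (- L) (min L (f x - c))" for x
    define f2 where "f2 x = f x - c - f1 x" for x
    have f1m: "f1 \<in> borel_measurable borel" "f2 \<in> borel_measurable borel"
      using f(1) unfolding f1_def f2_def by measurable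
    have f1b: "\<bar>f1 x\<bar> \<le> L" for x using L by (auto simp: f1_def)
    obtain B where B: "\<And>x. \<bar>f x\<bar> \<le> B" using f(2) by (auto simp: bounded_iff)
    have bd: "bounded (range f1)" "bounded (range f2)"
    proof -
      show "bounded (range f1)" using f1b by (auto simp: bounded_iff)
      have "\<bar>f2 x\<bar> \<le> B + \<bar>c\<bar> + L" for x using f1b[of x] B[of x] by (auto simp: f2_def)
      then show "bounded (range f2)" by (auto simp: bounded_iff)
    qed
    have f2b: "\<bar>f2 x\<bar> \<le> 0 + (L * \<beta>) * enn2real (V x)" if "V x < \<infinity>" for x
    proof -
      have "0 \<le> L * (\<beta> * enn2real (V x))" using L \<beta> by simp
      then show ?thesis
        using c[OF that] L unfolding f2_def f1_def by (simp add: algebra_simps abs_le_iff max_def min_def)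
    qed
    have L\<beta>: "L * \<beta> \<ge> 0" using L \<beta> by simp
    have 2: "\<bar>\<integral>x. f2 x \<partial>r\<bar> \<le> (L * \<beta>) * s"
      if r: "r \<in> space (prob_algebra borel)" and Vr: "(\<integral>\<^sup>+x. V x \<partial>r) \<le> ennreal s" "s \<ge> 0" for r s
    proof -
      note R = enn2real_of_finite_integral[OF r V Vr]
      have "AE x in r. \<bar>f2 x - 0\<bar> \<le> 0 + (L * \<beta>) * enn2real (V x)"
        using R(1) by eventually_elim (use f2b in auto)
      from abs_integral_diff_const_le[OF prob_algebraD(1)[OF r] integrable_bounded_borel[OF r f1m(2) bd(2)] R(2) this]
      show ?thesis using mult_left_mono[OF R(3) L\<beta>] by simp
    qed
    have split: "(\<integral>x. f x \<partial>r) = (\<integral>x. f1 x \<partial>r) + (\<integral>x. f2 x \<partial>r) + c"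
      if r: "r \<in> space (prob_algebra borel)" for r
    proof -
      interpret r: prob_space r using prob_algebraD(1)[OF r] .
      have "(\<integral>x. f x \<partial>r) = (\<integral>x. f1 x + f2 x + c \<partial>r)" by (simp add: f2_def)
      then show ?thesis
        using integrable_bounded_borel[OF r f1m(1) bd(1)] integrable_bounded_borel[OF r f1m(2) bd(2)]
        by (simp add: r.prob_space)
    qed
    have "\<bar>(\<integral>x. f1 x \<partial>p) - (\<integral>x. f1 x \<partial>q)\<bar> \<le> L * (2 * (1 - \<delta>))"
      using \<delta> L f1b by (intro abs_integral_diff_le_tv_norm_diff[OF tv[OF True] _ f1m(1)]) auto
    then have "\<bar>(\<integral>x. f x \<partial>p) - (\<integral>x. f x \<partial>q)\<bar> \<le>
        L * (2 * (1 - \<delta>)) + (L * \<beta>) * (a / 4 + K) + (L * \<beta>) * (b / 4 + K)"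
      using 2[OF p Vp nn(1)] 2[OF q Vq nn(2)] split[OF p] split[OF q] by linarith
    also have "\<dots> = L * (2 * (1 - \<delta>) + z / 4 + 2 * (\<beta> * K))"
      by (simp add: z_def algebra_simps)
    also have "\<dots> = L * (2 - \<delta> + z / 4)" by (simp add: \<beta>(2))
    finally have le: "\<bar>(\<integral>x. f x \<partial>p) - (\<integral>x. f x \<partial>q)\<bar> \<le> L * (2 - \<delta> + z / 4)" .
    have "0 \<le> (3/4 - \<delta>/8) * z" using \<delta> z0 by simp
    moreover have "(1 - \<delta> / 8) * (2 + z) = 2 + z / 4 + (3/4 - \<delta>/8) * z - \<delta> / 4"
      by (simp add: algebra_simps)
    ultimately show ?thesis
      using \<delta> by (intro goal[OF le]) linarith
  qed
qed

section \<open>Transition kernels\<close>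

locale markov_transition =
  fixes P :: "real \<Rightarrow> 'a::polish_space \<Rightarrow> real \<Rightarrow> 'a measure"
  assumes transition: "transition_probabilities P"
begin

lemma kernel: "s \<le> t \<Longrightarrow> (\<lambda>x. P s x t) \<in> borel \<rightarrow>\<^sub>M prob_algebra borel"
  using transition unfolding transition_probabilities_def by auto

lemma kernel_subprob: "s \<le> t \<Longrightarrow> (\<lambda>x. P s x t) \<in> borel \<rightarrow>\<^sub>M subprob_algebra borel"
  using kernel by (rule measurable_prob_algebraD)

lemma P_prob: "s \<le> t \<Longrightarrow> P s x t \<in> space (prob_algebra borel)"
  using measurable_space[OF kernel, of s t x] by simp

lemma P_refl: "P t x t = return borel x"
  using transition unfolding transition_probabilities_def by auto

lemma transition_operator_prob:
  assumes "s \<le> t" and p: "p \<in> space (prob_algebra borel)"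
  shows "transition_operator P s t p \<in> space (prob_algebra borel)"
  using prob_space_bind'[OF p kernel[OF assms(1)]] sets_bind'[OF p kernel[OF assms(1)]]
  by (simp add: transition_operator_def space_prob_algebra)

lemma chapman_kolmogorov:
  assumes "s \<le> u" "u \<le> t"
  shows "P s x t = transition_operator P u t (P s x u)"
proof (rule measure_eqI)
  have st: "s \<le> t" using assms by simp
  show "sets (P s x t) = sets (transition_operator P u t (P s x u))"
    using prob_algebraD(2)[OF P_prob[OF st]]
      prob_algebraD(2)[OF transition_operator_prob[OF assms(2) P_prob[OF assms(1)]]] by simp
  fix A assume "A \<in> sets (P s x t)"
  then have A: "A \<in> sets borel" using prob_algebraD(2)[OF P_prob[OF st]] by simp
  show "emeasure (P s x t) A = emeasure (transition_operator P u t (P s x u)) A"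
    using emeasure_transition_operator[OF transition assms(2) P_prob[OF assms(1)] A] transition A assms
    unfolding transition_probabilities_def by simp
qed

lemma borel_measurable_integral_P:
  fixes f :: "'a \<Rightarrow> real"
  assumes "s \<le> t" "f \<in> borel_measurable borel"
  shows "(\<lambda>x. \<integral>y. f y \<partial>P s x t) \<in> borel_measurable borel"
  using measurable_compose[OF kernel_subprob[OF assms(1)] integral_measurable_subprob_algebra[OF assms(2)]] .

lemma bounded_integral_P:
  fixes f :: "'a \<Rightarrow> real"
  assumes "s \<le> t" "f \<in> borel_measurable borel" "bounded (range f)"
  shows "bounded (range (\<lambda>x. \<integral>y. f y \<partial>P s x t))"
proof -
  obtain B where B: "\<And>x. \<bar>f x\<bar> \<le> B" using assms(3) by (auto simp: bounded_iff)
  have "\<bar>(\<integral>y. f y \<partial>P s x t) - 0\<bar> \<le> B + 0 * (\<integral>y. 0 \<partial>P s x t)" for x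
    using P_prob[OF assms(1)] assms B
    by (intro abs_integral_diff_const_le prob_algebraD integrable_bounded_borel) auto
  then show ?thesis by (auto simp: bounded_iff)
qed

lemma integral_transition_operator:
  fixes f :: "'a \<Rightarrow> real"
  assumes "s \<le> t" and p: "p \<in> space (prob_algebra borel)"
    and f: "f \<in> borel_measurable borel" "bounded (range f)"
  shows "(\<integral>y. f y \<partial>transition_operator P s t p) = (\<integral>x. \<integral>y. f y \<partial>P s x t \<partial>p)"
proof -
  obtain B where "\<And>x. \<bar>f x\<bar> \<le> B" using f(2) by (auto simp: bounded_iff)
  moreover have "(\<lambda>x. P s x t) \<in> p \<rightarrow>\<^sub>M subprob_algebra borel"
    using kernel_subprob[OF assms(1)] by (simp cong: measurable_cong_sets add: prob_algebraD(2)[OF p])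
  moreover have "finite_measure p"
    using prob_algebraD(1)[OF p] by (rule prob_space.finite_measure)
  moreover have "emeasure (P s x t) (space (P s x t)) \<le> ennreal 1" for x
    using prob_space.emeasure_space_1[OF prob_algebraD(1)[OF P_prob[OF assms(1)]]] by simp
  ultimately show ?thesis
    unfolding transition_operator_def using f(1) by (intro integral_bind[where K = borel and B = B and B' = 1]) auto
qed

lemma nn_integral_transition_operator:
  assumes "s \<le> t" and p: "p \<in> space (prob_algebra borel)"
    and f: "f \<in> borel_measurable borel"
  shows "(\<integral>\<^sup>+y. f y \<partial>transition_operator P s t p) = (\<integral>\<^sup>+x. \<integral>\<^sup>+y. f y \<partial>P s x t \<partial>p)"
  unfolding transition_operator_def using f kernel_subprob[OF assms(1)]
  by (intro nn_integral_bind[where B = borel]) (simp_all cong: measurable_cong_sets add: prob_algebraD(2)[OF p])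

text \<open>Integrating a test function against \<open>P u x t\<close> gives a test function in
  \<open>x\<close> with the same bound, so the later laws are compared on a smaller class of
  functions at time \<open>u\<close>.\<close>

lemma tv_norm_diff_P_antimono:
  assumes "s \<le> u" "u \<le> t" and tv: "tv_norm_diff (P s x u) (P s y u) \<le> ennreal c" and "c \<ge> 0"
  shows "tv_norm_diff (P s x t) (P s y t) \<le> ennreal c"
proof (rule tv_norm_diff_leI)
  fix f :: "'a \<Rightarrow> real" assume f: "f \<in> borel_measurable borel" "\<And>x. \<bar>f x\<bar> \<le> 1"
  then have b: "bounded (range f)" by (auto simp: bounded_iff)
  have "\<bar>(\<integral>y. f y \<partial>P u x t) - 0\<bar> \<le> 1 + 0 * (\<integral>y. 0 \<partial>P u x t)" for x
    using P_prob[OF assms(2)] f b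
    by (intro abs_integral_diff_const_le prob_algebraD integrable_bounded_borel) auto
  then have "\<bar>(\<integral>z. (\<integral>y. f y \<partial>P u z t) \<partial>P s x u) - (\<integral>z. (\<integral>y. f y \<partial>P u z t) \<partial>P s y u)\<bar> \<le> 1 * c"
    using assms f by (intro abs_integral_diff_le_tv_norm_diff[OF tv] borel_measurable_integral_P) auto
  then show "\<bar>(\<integral>z. f z \<partial>P s x t) - (\<integral>z. f z \<partial>P s y t)\<bar> \<le> c"
    by (simp add: chapman_kolmogorov[OF assms(1,2)] integral_transition_operator[OF assms(2) P_prob[OF assms(1)] f(1) b])
qed

end

section \<open>Geometric decay of the weighted oscillation\<close>

locale harris_transition = markov_transition P
  for P :: "real \<Rightarrow> 'a::polish_space \<Rightarrow> real \<Rightarrow> 'a measure" +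
  fixes V :: "'a \<Rightarrow> ennreal"
  assumes V: "V \<in> borel_measurable borel"
    and lyapunov: "lyapunov_condition P V"
    and doeblin: "local_doeblin_condition P V"
begin

abbreviation v :: "'a \<Rightarrow> real" where
  "v x \<equiv> enn2real (V x)"

lemma finite_point: "{x. V x < \<infinity>} \<noteq> {}"
  using lyapunov unfolding lyapunov_condition_def by simp

text \<open>The elapsed time is split into whole units, which contract at the rate for time
  \<open>1\<close>, and a remainder shorter than a unit, which costs one further additive
  constant.\<close>

lemma lyapunov_iterate:
  obtains \<gamma> K where "0 < \<gamma>" "\<gamma> < 1" "K > 0"
    and "\<And>x s t. t \<ge> 0 \<Longrightarrow> V x < \<infinity> \<Longrightarrow>
      (\<integral>\<^sup>+y. V y \<partial>P (s - t) x s) \<le> ennreal (\<gamma> ^ nat \<lfloor>t\<rfloor> * v x + K)"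
proof -
  obtain C where C: "C > 0"
    and L: "\<And>t. t > 0 \<Longrightarrow> \<exists>\<gamma>::real. 0 < \<gamma> \<and> \<gamma> < 1 \<and>
      (\<forall>x s. (\<integral>\<^sup>+y. V y \<partial>P (s - t) x s) \<le> ennreal \<gamma> * V x + ennreal C)"
    using lyapunov unfolding lyapunov_condition_def by auto
  obtain \<gamma> where \<gamma>: "0 < \<gamma>" "\<gamma> < 1"
    and one: "\<And>x s. (\<integral>\<^sup>+y. V y \<partial>P (s - 1) x s) \<le> ennreal \<gamma> * V x + ennreal C"
    using L[of 1] by auto
  \<comment> \<open>\<open>D\<close> is the fixed point of
    \<open>d \<mapsto> \<gamma> * d + C\<close>, so the additive constant stays the same under
    iteration.\<close>
  define D where "D = C / (1 - \<gamma>)"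
  have D: "D > 0" "\<gamma> * D + C = D" using C \<gamma> by (auto simp: D_def field_simps)
  have step: "(\<integral>\<^sup>+y. V y \<partial>P s x u) \<le> ennreal c * (\<integral>\<^sup>+y. V y \<partial>P s x t) + ennreal d"
    if st: "s \<le> t" "t \<le> u" and le: "\<And>y. (\<integral>\<^sup>+z. V z \<partial>P t y u) \<le> ennreal c * V y + ennreal d"
    for s t u x c d
  proof -
    note [measurable_cong] = prob_algebraD(2)[OF P_prob[OF st(1)]]
    note [measurable] = V
    interpret p: prob_space "P s x t" using prob_algebraD(1)[OF P_prob[OF st(1)]] .
    have "(\<integral>\<^sup>+y. V y \<partial>P s x u) = (\<integral>\<^sup>+y. \<integral>\<^sup>+z. V z \<partial>P t y u \<partial>P s x t)"
      by (simp add: chapman_kolmogorov[OF st] nn_integral_transition_operator[OF st(2) P_prob[OF st(1)] V])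
    also have "\<dots> \<le> (\<integral>\<^sup>+y. ennreal c * V y + ennreal d \<partial>P s x t)"
      by (intro nn_integral_mono le)
    also have "\<dots> = ennreal c * (\<integral>\<^sup>+y. V y \<partial>P s x t) + ennreal d"
      by (simp add: nn_integral_add nn_integral_cmult p.emeasure_space_1)
    finally show ?thesis .
  qed
  \<comment> \<open>Each step peels off the last unit of time, hence the induction varies the
    terminal time \<open>s\<close>.\<close>
  have iter: "(\<integral>\<^sup>+y. V y \<partial>P (s - real n) x s) \<le> ennreal (\<gamma> ^ n) * V x + ennreal D" for n s x
  proof (induction n arbitrary: s)
    case 0
    then show ?case using D V by (simp add: P_refl nn_integral_return)
  next
    case (Suc n)
    have "(\<integral>\<^sup>+y. V y \<partial>P (s - real (Suc n)) x s) \<le>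
        ennreal \<gamma> * (\<integral>\<^sup>+y. V y \<partial>P (s - real (Suc n)) x (s - 1)) + ennreal C"
      by (rule step) (simp_all add: one)
    also have "\<dots> \<le> ennreal \<gamma> * (ennreal (\<gamma> ^ n) * V x + ennreal D) + ennreal C"
      using Suc.IH[of "s - 1"] by (intro add_mono mult_left_mono) (auto simp: algebra_simps)
    also have "\<dots> = ennreal (\<gamma> ^ Suc n) * V x + (ennreal \<gamma> * ennreal D + ennreal C)"
      using \<gamma> by (simp add: distrib_left ennreal_mult mult.assoc add.assoc)
    also have "ennreal \<gamma> * ennreal D + ennreal C = ennreal (\<gamma> * D + C)"
      using \<gamma> D(1) C by (simp add: ennreal_mult)
    finally show ?case using D(2) by simp
  qed
  \<comment> \<open>The rate is weakened to \<open>1\<close>, since the one for time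
    \<open>r\<close> may approach \<open>1\<close> as \<open>r\<close> tends to \<open>0\<close>;
    what counts is the common \<open>C\<close>. At \<open>r = 0\<close> the kernel is a point
    mass.\<close>
  have short: "(\<integral>\<^sup>+y. V y \<partial>P (s - r) x s) \<le> ennreal 1 * V x + ennreal C" if r: "r \<ge> 0" for r s x
  proof (cases "r = 0")
    case True
    then show ?thesis using V by (simp add: P_refl nn_integral_return)
  next
    case False
    with r have "r > 0" by simp
    from L[OF this] obtain g where "0 < g" "g < 1" "(\<integral>\<^sup>+y. V y \<partial>P (s - r) x s) \<le> ennreal g * V x + ennreal C"
      by blast
    moreover from this have "ennreal g * V x \<le> ennreal 1 * V x"
      by (intro mult_right_mono ennreal_leI) auto
    ultimately show ?thesis by (meson add_right_mono order_trans)
  qed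
  have "(\<integral>\<^sup>+y. V y \<partial>P (s - t) x s) \<le> ennreal (\<gamma> ^ nat \<lfloor>t\<rfloor> * v x + (D + C))"
    if t: "t \<ge> 0" and x: "V x < \<infinity>" for s t x
  proof -
    define n where "n = nat \<lfloor>t\<rfloor>"
    have n: "real n \<le> t" using t by (simp add: n_def)
    \<comment> \<open>The whole units run first and the remainder \<open>t - real n\<close>
      last.\<close>
    have "(\<integral>\<^sup>+y. V y \<partial>P (s - t) x s) \<le> ennreal 1 * (\<integral>\<^sup>+y. V y \<partial>P (s - t) x (s - (t - real n))) + ennreal C"
      using n t by (intro step short) auto
    also have "\<dots> \<le> (ennreal (\<gamma> ^ n) * V x + ennreal D) + ennreal C"
      using iter[where n = n and s = "s - (t - real n)" and x = x] by (simp add: add_right_mono)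
    also have "V x = ennreal (v x)" using x by simp
    also have "(ennreal (\<gamma> ^ n) * ennreal (v x) + ennreal D) + ennreal C = ennreal (\<gamma> ^ n * v x + (D + C))"
      using \<gamma> D C by (simp add: ennreal_mult add.assoc)
    finally show ?thesis by (simp add: n_def)
  qed
  then show thesis using \<gamma> C D by (intro that[of \<gamma> "D + C"]) auto
qed

lemma weighted_osc_P_decay:
  obtains K \<beta> \<alpha> M where "K > 0" "\<beta> > 0" "0 < \<alpha>" "\<alpha> < 1" "M > 0"
    and "\<And>x s t. s \<le> t \<Longrightarrow> V x < \<infinity> \<Longrightarrow> (\<integral>\<^sup>+y. V y \<partial>P s x t) \<le> ennreal (v x + K)"
    and "\<And>s t f L. s \<le> t \<Longrightarrow> f \<in> borel_measurable borel \<Longrightarrow> bounded (range f) \<Longrightarrow> L \<ge> 0 \<Longrightarrow>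
      weighted_osc_le V \<beta> L f \<Longrightarrow> weighted_osc_le V \<beta> (M * \<alpha> powr (t - s) * L) (\<lambda>x. \<integral>y. f y \<partial>P s x t)"
proof -
  obtain \<gamma> K where \<gamma>: "0 < \<gamma>" "\<gamma> < 1" and K: "K > 0"
    and lyap: "\<And>x s t. t \<ge> 0 \<Longrightarrow> V x < \<infinity> \<Longrightarrow>
      (\<integral>\<^sup>+y. V y \<partial>P (s - t) x s) \<le> ennreal (\<gamma> ^ nat \<lfloor>t\<rfloor> * v x + K)"
    by (rule lyapunov_iterate) blast
  \<comment> \<open>After \<open>m\<close> units the Lyapunov factor is below \<open>1/4\<close>,
    the value that \<open>harris_contraction\<close> works with.\<close>
  obtain m where m: "\<gamma> ^ m < 1 / 4"
    using real_arch_pow_inv[of "1/4" \<gamma>] \<gamma> by auto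
  have "4 * K > 0" using K by simp
  then obtain t0 \<delta> where t0: "t0 > 0" and \<delta>: "0 < \<delta>" "\<delta> < 1"
    and sup: "\<And>t. (SUP (x, y)\<in>{(x, y). V x + V y \<le> ennreal (4 * K)}.
        tv_norm_diff (P (t - t0) x t) (P (t - t0) y t)) \<le> ennreal (2 * (1 - \<delta>))"
    using doeblin unfolding local_doeblin_condition_def by blast
  define T where "T = max t0 (real m)"
  have T: "T > 0" "T \<ge> t0" "T \<ge> real m" using t0 by (auto simp: T_def)
  define \<beta> where "\<beta> = \<delta> / (2 * K)"
  define \<kappa> where "\<kappa> = 1 - \<delta> / 8"
  have \<beta>: "\<beta> > 0" using K \<delta> by (simp add: \<beta>_def)
  have \<kappa>: "0 < \<kappa>" "\<kappa> < 1" using \<delta> by (auto simp: \<kappa>_def)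
  have bound: "(\<integral>\<^sup>+y. V y \<partial>P s x t) \<le> ennreal (v x + K)" if "s \<le> t" "V x < \<infinity>" for x s t
  proof -
    have "\<gamma> ^ nat \<lfloor>t - s\<rfloor> * v x \<le> 1 * v x"
      using \<gamma> by (intro mult_right_mono power_le_one) auto
    then show ?thesis
      using lyap[of "t - s" x t] that by (auto intro: order_trans[OF _ ennreal_leI])
  qed
  have boundT: "(\<integral>\<^sup>+y. V y \<partial>P (t - T) x t) \<le> ennreal (v x / 4 + K)" if "V x < \<infinity>" for x t
  proof -
    have "\<gamma> ^ nat \<lfloor>T\<rfloor> \<le> \<gamma> ^ m"
      using \<gamma> T by (intro power_decreasing) (auto simp: le_nat_floor)
    then have "\<gamma> ^ nat \<lfloor>T\<rfloor> * v x \<le> 1 / 4 * v x"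
      using m by (intro mult_right_mono) auto
    then show ?thesis
      using lyap[of T x t] that T by (auto intro: order_trans[OF _ ennreal_leI])
  qed
  have sup': "tv_norm_diff (P (t - t0) x t) (P (t - t0) y t) \<le> ennreal (2 * (1 - \<delta>))"
    if "V x + V y \<le> ennreal (4 * K)" for x y t
  proof -
    have "(x, y) \<in> {(x, y). V x + V y \<le> ennreal (4 * K)}" using that by simp
    from order_trans[OF SUP_upper[OF this] sup[of t]] show ?thesis by (simp only: prod.case)
  qed
  have tv: "tv_norm_diff (P (t - T) x t) (P (t - T) y t) \<le> ennreal (2 * (1 - \<delta>))"
    if xy: "V x < \<infinity>" "V y < \<infinity>" "v x + v y \<le> 4 * K" for x y t
  proof -
    have "ennreal (v x) + ennreal (v y) \<le> ennreal (4 * K)"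
      using ennreal_leI[OF xy(3)] by simp
    moreover have "ennreal (v x) = V x" "ennreal (v y) = V y" using xy by auto
    ultimately have "V x + V y \<le> ennreal (4 * K)" by (simp only:)
    \<comment> \<open>The Doeblin bound is taken over the first \<open>t0\<close> time units after
      the start at \<open>t - T\<close>; the rest of the period cannot increase it.\<close>
    from sup'[OF this, of "t - T + t0"]
    have "tv_norm_diff (P (t - T) x (t - T + t0)) (P (t - T) y (t - T + t0)) \<le> ennreal (2 * (1 - \<delta>))"
      by simp
    then show ?thesis
      by (rule tv_norm_diff_P_antimono[rotated 2]) (use T t0 \<delta> in simp_all)
  qed
  have contr: "weighted_osc_le V \<beta> (\<kappa> * L) (\<lambda>x. \<integral>y. f y \<partial>P (t - T) x t)"
    if f: "f \<in> borel_measurable borel" "bounded (range f)" and L: "L \<ge> 0"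
      and osc: "weighted_osc_le V \<beta> L f" for t f L
    unfolding weighted_osc_le_def \<kappa>_def \<beta>_def
  proof (intro allI impI)
    fix x y assume xy: "V x < \<infinity>" "V y < \<infinity>"
    have le: "t - T \<le> t" using T by simp
    show "\<bar>(\<integral>z. f z \<partial>P (t - T) x t) - (\<integral>z. f z \<partial>P (t - T) y t)\<bar>
      \<le> (1 - \<delta> / 8) * L * (2 + \<delta> / (2 * K) * (v x + v y))"
      by (rule harris_contraction[OF P_prob[OF le] P_prob[OF le] V finite_point f K \<delta> L
            osc[unfolded \<beta>_def] enn2real_nonneg enn2real_nonneg boundT[OF xy(1)] boundT[OF xy(2)] tv[OF xy]])
  qed
  \<comment> \<open>A stretch of any length, in particular one shorter than \<open>T\<close>,
    enlarges the oscillation at most by \<open>1 + \<beta> * K\<close>, because each moment grows at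
    most by \<open>K\<close>.\<close>
  have short: "weighted_osc_le V \<beta> ((1 + \<beta> * K) * L) (\<lambda>x. \<integral>y. f y \<partial>P s x t)"
    if st: "s \<le> t" and f: "f \<in> borel_measurable borel" "bounded (range f)" and L: "L \<ge> 0"
      and osc: "weighted_osc_le V \<beta> L f" for s t f L
    unfolding weighted_osc_le_def
  proof (intro allI impI)
    fix x y assume xy: "V x < \<infinity>" "V y < \<infinity>"
    have nn: "v x + K \<ge> 0" "v y + K \<ge> 0" using K by (auto intro: add_nonneg_nonneg)
    have "\<bar>(\<integral>z. f z \<partial>P s x t) - (\<integral>z. f z \<partial>P s y t)\<bar> \<le> L * (2 + \<beta> * ((v x + K) + (v y + K)))"
      using \<beta> by (intro weighted_osc_integral_diff[OF P_prob[OF st] P_prob[OF st] V f osc _ L] bound st xy nn) auto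
    also have "\<dots> \<le> L * ((1 + \<beta> * K) * (2 + \<beta> * (v x + v y)))"
    proof (rule mult_left_mono[OF _ L])
      have "0 \<le> (\<beta> * K) * (\<beta> * (v x + v y))" using \<beta> K by simp
      then show "2 + \<beta> * ((v x + K) + (v y + K)) \<le> (1 + \<beta> * K) * (2 + \<beta> * (v x + v y))"
        by (simp add: algebra_simps)
    qed
    finally show "\<bar>(\<integral>z. f z \<partial>P s x t) - (\<integral>z. f z \<partial>P s y t)\<bar> \<le> (1 + \<beta> * K) * L * (2 + \<beta> * (v x + v y))"
      by (simp add: mult_ac)
  qed
  \<comment> \<open>The incomplete period from \<open>s\<close> to \<open>t\<close> comes last in
    time, and the induction prepends full periods before \<open>s\<close>.\<close>
  have iter: "weighted_osc_le V \<beta> (\<kappa> ^ n * ((1 + \<beta> * K) * L)) (\<lambda>x. \<integral>y. f y \<partial>P (s - real n * T) x t)"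
    if st: "s \<le> t" and f: "f \<in> borel_measurable borel" "bounded (range f)" and L: "L \<ge> 0"
      and osc: "weighted_osc_le V \<beta> L f" for s t f L n
  proof (induction n)
    case 0
    then show ?case using short[OF that] by simp
  next
    case (Suc n)
    let ?u = "s - real n * T"
    have u: "?u - T \<le> ?u" "?u \<le> t" using st T by (auto intro: order_trans[OF _ st])
    have "weighted_osc_le V \<beta> (\<kappa> * (\<kappa> ^ n * ((1 + \<beta> * K) * L)))
        (\<lambda>x. \<integral>z. (\<integral>y. f y \<partial>P ?u z t) \<partial>P (?u - T) x ?u)"
      using \<kappa> \<beta> K L by (intro contr[OF _ _ _ Suc.IH] borel_measurable_integral_P bounded_integral_P u f) auto
    moreover have "(\<integral>z. (\<integral>y. f y \<partial>P ?u z t) \<partial>P (?u - T) x ?u) = (\<integral>y. f y \<partial>P (s - real (Suc n) * T) x t)" for x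
      using chapman_kolmogorov[OF u, of x] integral_transition_operator[OF u(2) P_prob[OF u(1)] f, of x]
      by (simp add: algebra_simps)
    ultimately show ?case by (simp add: mult.assoc)
  qed
  \<comment> \<open>\<open>\<alpha>\<close> spreads the contraction \<open>\<kappa>\<close> evenly
    over a period of length \<open>T\<close>; the division by \<open>\<kappa>\<close> in
    \<open>M\<close> pays for rounding the number of periods down.\<close>
  define \<alpha> where "\<alpha> = \<kappa> powr (1 / T)"
  define M where "M = (1 + \<beta> * K) / \<kappa>"
  have \<alpha>: "0 < \<alpha>" "\<alpha> < 1"
    using \<kappa> T powr_less_mono2[of "1 / T" \<kappa> 1] by (auto simp: \<alpha>_def)
  have M: "M > 0" using \<beta> K \<kappa> by (auto simp: M_def intro!: divide_pos_pos add_pos_pos)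
  have decay: "weighted_osc_le V \<beta> (M * \<alpha> powr (t - s) * L) (\<lambda>x. \<integral>y. f y \<partial>P s x t)"
    if st: "s \<le> t" and f: "f \<in> borel_measurable borel" "bounded (range f)" and L: "L \<ge> 0"
      and osc: "weighted_osc_le V \<beta> L f" for s t f L
  proof -
    define n where "n = nat \<lfloor>(t - s) / T\<rfloor>"
    have q: "(t - s) / T \<ge> 0" using st T by simp
    have n: "real n \<le> (t - s) / T" "(t - s) / T - 1 \<le> real n"
      using q unfolding n_def by linarith+
    have "s + real n * T \<le> t" using n(1) T by (simp add: field_simps)
    from iter[OF this f L osc, of n]
    have o: "weighted_osc_le V \<beta> (\<kappa> ^ n * ((1 + \<beta> * K) * L)) (\<lambda>x. \<integral>y. f y \<partial>P s x t)"
      by simp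
    have "\<kappa> ^ n = \<kappa> powr real n" using \<kappa> by (simp add: powr_realpow)
    also have "\<dots> \<le> \<kappa> powr ((t - s) / T - 1)"
      using \<kappa> n by (intro powr_mono') auto
    also have "\<dots> = \<alpha> powr (t - s) / \<kappa>"
      using \<kappa> by (subst powr_diff) (simp add: \<alpha>_def powr_powr)
    finally have "\<kappa> ^ n * ((1 + \<beta> * K) * L) \<le> \<alpha> powr (t - s) / \<kappa> * ((1 + \<beta> * K) * L)"
      using L \<beta> K by (intro mult_right_mono) auto
    also have "\<dots> = M * \<alpha> powr (t - s) * L" by (simp add: M_def)
    finally have "\<kappa> ^ n * ((1 + \<beta> * K) * L) \<le> M * \<alpha> powr (t - s) * L" .
    moreover have "0 \<le> 2 + \<beta> * (v x + v y)" for x y using \<beta> by simp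
    ultimately show ?thesis
      using o unfolding weighted_osc_le_def by (meson mult_right_mono order_trans)
  qed
  show thesis
    by (rule that[OF K \<beta> \<alpha> M bound decay])
qed

end

section \<open>The invariant family\<close>

text \<open>The outcome of the contraction argument in isolation: from here on the Lyapunov and
  Doeblin conditions enter only through the decay of oscillations and a moment bound uniform in the
  elapsed time.\<close>

locale weighted_decay = markov_transition P
  for P :: "real \<Rightarrow> 'a::polish_space \<Rightarrow> real \<Rightarrow> 'a measure" +
  fixes V :: "'a \<Rightarrow> ennreal" and K \<beta> \<alpha> M :: real
  assumes V: "V \<in> borel_measurable borel"
    and finite_point: "{x. V x < \<infinity>} \<noteq> {}"
    and K: "K > 0" and \<beta>: "\<beta> > 0" and \<alpha>: "0 < \<alpha>" "\<alpha> < 1" and M: "M > 0"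
    and moment_bound: "\<And>x s t. s \<le> t \<Longrightarrow> V x < \<infinity> \<Longrightarrow>
      (\<integral>\<^sup>+y. V y \<partial>P s x t) \<le> ennreal (enn2real (V x) + K)"
    and decay: "\<And>s t f L. s \<le> t \<Longrightarrow> f \<in> borel_measurable borel \<Longrightarrow> bounded (range f) \<Longrightarrow> L \<ge> 0 \<Longrightarrow>
      weighted_osc_le V \<beta> L f \<Longrightarrow> weighted_osc_le V \<beta> (M * \<alpha> powr (t - s) * L) (\<lambda>x. \<integral>y. f y \<partial>P s x t)"
begin

section \<open>Comparison of two laws under the same evolution\<close>

abbreviation v :: "'a \<Rightarrow> real" where
  "v x \<equiv> enn2real (V x)"

text \<open>The additive \<open>2\<close> in the weighted distance makes every total variation test
  function Lipschitz with constant \<open>1\<close>, whatever the weight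
  \<open>\<beta>\<close>.\<close>

lemma weighted_osc_le_unit:
  fixes f :: "'a \<Rightarrow> real"
  assumes "\<And>x. \<bar>f x\<bar> \<le> 1"
  shows "weighted_osc_le V \<beta> 1 f"
  unfolding weighted_osc_le_def
proof (intro allI impI)
  fix x y
  have "0 \<le> \<beta> * (v x + v y)" using \<beta> by simp
  then show "\<bar>f x - f y\<bar> \<le> 1 * (2 + \<beta> * (v x + v y))"
    using assms[of x] assms[of y] by simp
qed

text \<open>Dual form of the decay: the evolution is moved from the measures onto \<open>f\<close>,
  whose oscillation shrinks, and the initial laws enter only through their moments.\<close>

lemma transition_operator_diff_le:
  assumes st: "s \<le> t"
    and p: "p \<in> space (prob_algebra borel)" "(\<integral>\<^sup>+x. V x \<partial>p) \<le> ennreal a" "a \<ge> 0"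
    and q: "q \<in> space (prob_algebra borel)" "(\<integral>\<^sup>+x. V x \<partial>q) \<le> ennreal b" "b \<ge> 0"
    and f: "f \<in> borel_measurable borel" "bounded (range f)" and L: "L \<ge> 0" "weighted_osc_le V \<beta> L f"
  shows "\<bar>(\<integral>x. f x \<partial>transition_operator P s t p) - (\<integral>x. f x \<partial>transition_operator P s t q)\<bar>
    \<le> M * \<alpha> powr (t - s) * L * (2 + \<beta> * (a + b))"
proof -
  have "0 \<le> M * \<alpha> powr (t - s) * L" using M L(1) by simp
  from weighted_osc_integral_diff[OF p(1) q(1) V borel_measurable_integral_P[OF st f(1)]
      bounded_integral_P[OF st f] decay[OF st f L] less_imp_le[OF \<beta>] this p(2,3) q(2,3)]
  show ?thesis
    by (simp only: integral_transition_operator[OF st p(1) f] integral_transition_operator[OF st q(1) f])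
qed

lemma P_eq_transition_operator_return:
  "s \<le> t \<Longrightarrow> P s x t = transition_operator P s t (return borel x)"
  using chapman_kolmogorov[of s s t x] by (simp add: P_refl)

lemma return_prob: "return borel x \<in> space (prob_algebra borel)"
  by (simp add: space_prob_algebra prob_space_return)

lemma P_diff_le:
  assumes st: "s \<le> t" and x: "V x < \<infinity>"
    and q: "q \<in> space (prob_algebra borel)" "(\<integral>\<^sup>+x. V x \<partial>q) \<le> ennreal b" "b \<ge> 0"
    and f: "f \<in> borel_measurable borel" "bounded (range f)" and L: "L \<ge> 0" "weighted_osc_le V \<beta> L f"
  shows "\<bar>(\<integral>y. f y \<partial>P s x t) - (\<integral>x. f x \<partial>transition_operator P s t q)\<bar>
    \<le> M * \<alpha> powr (t - s) * L * (2 + \<beta> * (v x + b))"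
  unfolding P_eq_transition_operator_return[OF st] using V x
  by (intro transition_operator_diff_le[OF st return_prob _ _ q f L]) (auto simp: nn_integral_return)

section \<open>Pullback laws from a base point and their limits\<close>

definition base_point :: 'a where
  "base_point = (SOME x. V x < \<infinity>)"

lemma base_point: "V base_point < \<infinity>"
  unfolding base_point_def using finite_point by (auto intro: someI_ex)

text \<open>A bound for the integral of \<open>V\<close> under every law started in
  \<open>base_point\<close>, independent of the elapsed time; it survives the passage to the
  limit.\<close>

definition moment :: real where
  "moment = v base_point + K"

definition cauchy_const :: real where
  "cauchy_const = M * (2 + \<beta> * (v base_point + moment))"

lemma moment_pos: "moment > 0" and cauchy_const_pos: "cauchy_const > 0"
proof -
  show *: "moment > 0" using K by (auto simp: moment_def intro: add_nonneg_pos)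
  show "cauchy_const > 0" using M \<beta> * by (auto simp: cauchy_const_def intro!: mult_pos_pos add_pos_nonneg)
qed

text \<open>By Chapman--Kolmogorov the earlier start amounts to a random start at time
  \<open>\<tau> - s\<close>, with law \<open>P (\<tau> - t) base_point (\<tau> - s)\<close>. Both
  laws then share the evolution over time \<open>s\<close>.\<close>

lemma pullback_diff_le:
  assumes st: "0 \<le> s" "s \<le> t" and A: "A \<in> sets borel"
  shows "\<bar>measure (P (\<tau> - t) base_point \<tau>) A - measure (P (\<tau> - s) base_point \<tau>) A\<bar>
    \<le> cauchy_const * \<alpha> powr s"
proof -
  let ?q = "P (\<tau> - t) base_point (\<tau> - s)"
  have q: "?q \<in> space (prob_algebra borel)" using st by (intro P_prob) auto
  have Vq: "(\<integral>\<^sup>+x. V x \<partial>?q) \<le> ennreal moment"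
    unfolding moment_def using st base_point by (intro moment_bound) auto
  have "\<bar>(\<integral>y. indicator A y \<partial>P (\<tau> - s) base_point \<tau>) -
      (\<integral>x. indicator A x \<partial>transition_operator P (\<tau> - s) \<tau> ?q)\<bar>
    \<le> M * \<alpha> powr (\<tau> - (\<tau> - s)) * 1 * (2 + \<beta> * (v base_point + moment))"
    using st A moment_pos
    by (intro P_diff_le[OF _ base_point q Vq] weighted_osc_le_unit)
      (auto simp: indicator_def bounded_iff intro!: exI[of _ 1])
  also have "transition_operator P (\<tau> - s) \<tau> ?q = P (\<tau> - t) base_point \<tau>"
    using st by (intro chapman_kolmogorov[symmetric]) auto
  finally show ?thesis
    using st prob_algebraD(3)[OF P_prob[of "\<tau> - s" \<tau>]] prob_algebraD(3)[OF P_prob[of "\<tau> - t" \<tau>]]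
    by (simp add: cauchy_const_def abs_minus_commute mult_ac)
qed

lemma pullback_limit_exists:
  "\<exists>\<mu>. \<mu> \<in> space (prob_algebra borel) \<and> (\<forall>A\<in>sets borel.
    (\<lambda>n. measure (P (\<tau> - real n) base_point \<tau>) A) \<longlonglongrightarrow> measure \<mu> A)"
proof -
  have "\<exists>n\<^sub>0. \<forall>n\<ge>n\<^sub>0. \<forall>k\<ge>n\<^sub>0. \<forall>A\<in>sets borel.
      \<bar>measure (P (\<tau> - real n) base_point \<tau>) A - measure (P (\<tau> - real k) base_point \<tau>) A\<bar> < \<epsilon>"
    if e: "\<epsilon> > 0" for \<epsilon>
  proof -
    \<comment> \<open>The laws for \<open>n\<close> and \<open>k\<close> are compared through the
      one for \<open>n0\<close>, which uses the estimate twice.\<close>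
    obtain n0 where n0: "\<alpha> ^ n0 < \<epsilon> / (2 * cauchy_const)"
      using real_arch_pow_inv[of "\<epsilon> / (2 * cauchy_const)" \<alpha>] e cauchy_const_pos \<alpha> by auto
    then have n0': "2 * (cauchy_const * \<alpha> powr real n0) < \<epsilon>"
      using cauchy_const_pos \<alpha> by (simp add: powr_realpow field_simps)
    have "\<bar>measure (P (\<tau> - real n) base_point \<tau>) A - measure (P (\<tau> - real k) base_point \<tau>) A\<bar> < \<epsilon>"
      if "n \<ge> n0" "k \<ge> n0" "A \<in> sets borel" for n k A
      using pullback_diff_le[of "real n0" "real n" A \<tau>] pullback_diff_le[of "real n0" "real k" A \<tau>]
        that n0' by simp
    then show ?thesis by blast
  qed
  then show ?thesis
    by (rule uniform_Cauchy_imp_setwise_limit[of "\<lambda>n. P (\<tau> - real n) base_point \<tau>" borel, rotated])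
      (auto intro!: P_prob)
qed

definition pullback_limit :: "real \<Rightarrow> 'a measure" where
  "pullback_limit \<tau> = (SOME \<mu>. \<mu> \<in> space (prob_algebra borel) \<and> (\<forall>A\<in>sets borel.
    (\<lambda>n. measure (P (\<tau> - real n) base_point \<tau>) A) \<longlonglongrightarrow> measure \<mu> A))"

lemma pullback_limit_prob: "pullback_limit \<tau> \<in> space (prob_algebra borel)"
  and pullback_limit_tendsto: "A \<in> sets borel \<Longrightarrow>
    (\<lambda>n. measure (P (\<tau> - real n) base_point \<tau>) A) \<longlonglongrightarrow> measure (pullback_limit \<tau>) A"
  using someI_ex[OF pullback_limit_exists[of \<tau>]] unfolding pullback_limit_def by auto

text \<open>The limit is defined along integer times, but the Cauchy estimate compares real times
  with integer ones, so the rate holds for every real \<open>t\<close>.\<close>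

lemma pullback_limit_measure_diff_le:
  assumes t: "t \<ge> 0" and A: "A \<in> sets borel"
  shows "\<bar>measure (P (\<tau> - t) base_point \<tau>) A - measure (pullback_limit \<tau>) A\<bar> \<le> cauchy_const * \<alpha> powr t"
proof (rule LIMSEQ_le_const2)
  show "(\<lambda>n. \<bar>measure (P (\<tau> - t) base_point \<tau>) A - measure (P (\<tau> - real n) base_point \<tau>) A\<bar>)
    \<longlonglongrightarrow> \<bar>measure (P (\<tau> - t) base_point \<tau>) A - measure (pullback_limit \<tau>) A\<bar>"
    by (intro tendsto_intros pullback_limit_tendsto A)
  show "\<exists>N. \<forall>n\<ge>N. \<bar>measure (P (\<tau> - t) base_point \<tau>) A - measure (P (\<tau> - real n) base_point \<tau>) A\<bar>
    \<le> cauchy_const * \<alpha> powr t"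
  proof (intro exI[of _ "nat \<lceil>t\<rceil>"] allI impI)
    fix n assume "nat \<lceil>t\<rceil> \<le> n"
    then have "t \<le> real n" by linarith
    from pullback_diff_le[OF t this A, of \<tau>]
    show "\<bar>measure (P (\<tau> - t) base_point \<tau>) A - measure (P (\<tau> - real n) base_point \<tau>) A\<bar>
      \<le> cauchy_const * \<alpha> powr t"
      by (simp add: abs_minus_commute)
  qed
qed

lemma pullback_limit_integral_diff_le:
  assumes "t \<ge> 0" "f \<in> borel_measurable borel" "\<And>x. \<bar>f x\<bar> \<le> 1"
  shows "\<bar>(\<integral>x. f x \<partial>P (\<tau> - t) base_point \<tau>) - (\<integral>x. f x \<partial>pullback_limit \<tau>)\<bar>
    \<le> 2 * (cauchy_const * \<alpha> powr t)"
  using assms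
  by (intro abs_integral_diff_le_of_sets P_prob pullback_limit_prob pullback_limit_measure_diff_le) auto

text \<open>\<open>V\<close> may be unbounded, so the convergence on bounded functions is applied to
  its truncations; monotone convergence then recovers \<open>V\<close>.\<close>

lemma pullback_limit_moment: "(\<integral>\<^sup>+x. V x \<partial>pullback_limit \<tau>) \<le> ennreal moment"
proof -
  note [measurable_cong] = prob_algebraD(2)[OF pullback_limit_prob[of \<tau>]]
  note [measurable] = V
  have trunc: "(\<integral>\<^sup>+x. min (V x) (ennreal N) \<partial>pullback_limit \<tau>) \<le> ennreal moment" if N: "N > 0" for N :: real
  proof -
    \<comment> \<open>Division by \<open>N\<close> turns the truncation into a test function bounded
      by \<open>1\<close>. For fixed \<open>N\<close> the convergence error is geometric in
      \<open>n\<close> and disappears in the limit.\<close>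
    define f where "f x = enn2real (min (V x) (ennreal N)) / N" for x
    have minN: "min (V x) (ennreal N) < top" for x
      by (simp add: min_less_iff_disj)
    have eN: "ennreal (N * f x) = min (V x) (ennreal N)" for x
      using minN[of x] N by (simp add: f_def)
    have f: "f \<in> borel_measurable borel" unfolding f_def by measurable
    have "enn2real (min (V x) (ennreal N)) \<le> N" for x
      using N by (intro enn2real_leI) auto
    then have f01: "0 \<le> f x" "\<bar>f x\<bar> \<le> 1" for x using N by (auto simp: f_def)
    then have bf: "bounded (range f)" by (auto simp: bounded_iff)
    have int: "(\<integral>\<^sup>+x. min (V x) (ennreal N) \<partial>r) = ennreal (N * (\<integral>x. f x \<partial>r))"
      if r: "r \<in> space (prob_algebra borel)" for r
      using integrable_bounded_borel[OF r f bf] f01 N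
      by (subst nn_integral_eq_integral[symmetric, of r "\<lambda>x. N * f x", unfolded eN integral_mult_right_zero]) auto
    have "N * (\<integral>x. f x \<partial>P (\<tau> - real n) base_point \<tau>) \<le> moment" for n
    proof -
      have "(\<integral>\<^sup>+x. min (V x) (ennreal N) \<partial>P (\<tau> - real n) base_point \<tau>)
          \<le> (\<integral>\<^sup>+x. V x \<partial>P (\<tau> - real n) base_point \<tau>)"
        by (intro nn_integral_mono) simp
      also have "\<dots> \<le> ennreal moment"
        unfolding moment_def by (intro moment_bound base_point) simp
      finally show ?thesis
        using moment_pos by (simp add: int[OF P_prob])
    qed
    then have "N * (\<integral>x. f x \<partial>pullback_limit \<tau>) \<le> moment + N * (2 * cauchy_const) * \<alpha> ^ n" for n
    proof -
      have "(\<integral>x. f x \<partial>pullback_limit \<tau>) \<le> (\<integral>x. f x \<partial>P (\<tau> - real n) base_point \<tau>) + 2 * (cauchy_const * \<alpha> ^ n)"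
        using pullback_limit_integral_diff_le[of "real n" f \<tau>] f f01 \<alpha>
        by (simp add: powr_realpow)
      from mult_left_mono[OF this less_imp_le[OF N]]
      show ?thesis
        using \<open>\<And>n. N * (\<integral>x. f x \<partial>P (\<tau> - real n) base_point \<tau>) \<le> moment\<close>[of n]
        by (simp add: algebra_simps)
    qed
    moreover have "(\<lambda>n. moment + N * (2 * cauchy_const) * \<alpha> ^ n) \<longlonglongrightarrow> moment + N * (2 * cauchy_const) * 0"
      using \<alpha> by (intro tendsto_intros LIMSEQ_power_zero) auto
    ultimately have "N * (\<integral>x. f x \<partial>pullback_limit \<tau>) \<le> moment + N * (2 * cauchy_const) * 0"
      by (intro LIMSEQ_le_const) auto
    then show ?thesis
      by (simp add: int[OF pullback_limit_prob] ennreal_leI)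
  qed
  have "V x = (SUP n. min (V x) (of_nat n))" for x
    using inf_SUP[of "V x" "of_nat :: nat \<Rightarrow> ennreal" UNIV]
    by (simp add: inf_min ennreal_SUP_of_nat_eq_top)
  then have "(\<integral>\<^sup>+x. V x \<partial>pullback_limit \<tau>) = (\<integral>\<^sup>+x. (SUP n. min (V x) (of_nat n)) \<partial>pullback_limit \<tau>)"
    by simp
  also have "\<dots> = (SUP n. \<integral>\<^sup>+x. min (V x) (of_nat n) \<partial>pullback_limit \<tau>)"
    by (intro nn_integral_monotone_convergence_SUP)
      (simp_all add: incseq_def le_fun_def min.coboundedI2)
  also have "\<dots> \<le> ennreal moment"
  proof (rule SUP_least)
    fix n :: nat
    \<comment> \<open>The level is raised by one because \<open>trunc\<close> asks for a positive
      level and \<open>n\<close> may be \<open>0\<close>.\<close>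
    have "(\<integral>\<^sup>+x. min (V x) (of_nat n) \<partial>pullback_limit \<tau>)
        \<le> (\<integral>\<^sup>+x. min (V x) (ennreal (real n + 1)) \<partial>pullback_limit \<tau>)"
      by (intro nn_integral_mono min.mono) (auto simp: ennreal_of_nat_eq_real_of_nat intro!: ennreal_leI)
    also have "\<dots> \<le> ennreal moment" by (rule trunc) simp
    finally show "(\<integral>\<^sup>+x. min (V x) (of_nat n) \<partial>pullback_limit \<tau>) \<le> ennreal moment" .
  qed
  finally show ?thesis .
qed

section \<open>Invariance and uniqueness of the limit family\<close>

lemma measure_transition_operator:
  assumes "s \<le> t" and p: "p \<in> space (prob_algebra borel)" and A: "A \<in> sets borel"
  shows "measure (transition_operator P s t p) A = (\<integral>x. measure (P s x t) A \<partial>p)"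
proof -
  have "bounded (range (indicator A :: 'a \<Rightarrow> real))"
    by (auto simp: bounded_iff indicator_def intro!: exI[of _ 1])
  with A show ?thesis
    using integral_transition_operator[OF assms(1) p, of "indicator A"]
    by (simp add: prob_algebraD(3)[OF transition_operator_prob[OF assms(1) p]]
        prob_algebraD(3)[OF P_prob[OF assms(1)]])
qed

text \<open>Evolving the pullback law at \<open>s\<close> up to time \<open>t\<close> gives the
  pullback law at \<open>t\<close> with the same starting time, so both sides are limits of the same
  laws.\<close>

lemma invariant_pullback_limit: "invariant_measure_family P pullback_limit"
  unfolding invariant_measure_family_def
proof (intro conjI allI impI)
  fix s t :: real assume st: "s \<le> t"
  show "transition_operator P s t (pullback_limit s) = pullback_limit t"
  proof (rule prob_algebra_eqI[OF transition_operator_prob[OF st pullback_limit_prob] pullback_limit_prob])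
    fix A :: "'a set" assume A: "A \<in> sets borel"
    \<comment> \<open>\<open>g\<close> is the indicator of \<open>A\<close> moved back from
      \<open>t\<close> to \<open>s\<close>; being bounded by \<open>1\<close>, it may be used to
      test the convergence at time \<open>s\<close>.\<close>
    define g where "g x = measure (P s x t) A" for x
    have g: "g \<in> borel_measurable borel"
      unfolding g_def using A kernel[OF st] by measurable
    have g1: "\<bar>g x\<bar> \<le> 1" for x
      using prob_space.prob_le_1[OF prob_algebraD(1)[OF P_prob[OF st]]] by (simp add: g_def)
    show "measure (transition_operator P s t (pullback_limit s)) A = measure (pullback_limit t) A"
    proof (rule eq_if_diff_le_geometric[OF \<alpha>])
      fix n
      have "(\<integral>x. g x \<partial>P (s - real n) base_point s) = measure (P (t - (t - s + real n)) base_point t) A"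
        unfolding g_def using measure_transition_operator[OF st P_prob A, of "s - real n" s base_point]
          chapman_kolmogorov[of "s - real n" s t base_point] st by simp
      moreover have "\<bar>measure (P (t - (t - s + real n)) base_point t) A - measure (pullback_limit t) A\<bar>
          \<le> cauchy_const * \<alpha> powr (t - s + real n)"
        using st by (intro pullback_limit_measure_diff_le A) auto
      moreover have "\<alpha> powr (t - s + real n) \<le> \<alpha> powr real n"
        using \<alpha> st by (intro powr_mono') auto
      then have "cauchy_const * \<alpha> powr (t - s + real n) \<le> cauchy_const * \<alpha> powr real n"
        using cauchy_const_pos by (intro mult_left_mono) auto
      moreover have "\<bar>(\<integral>x. g x \<partial>P (s - real n) base_point s) - (\<integral>x. g x \<partial>pullback_limit s)\<bar>
          \<le> 2 * (cauchy_const * \<alpha> powr real n)"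
        by (intro pullback_limit_integral_diff_le g g1) auto
      moreover have "measure (transition_operator P s t (pullback_limit s)) A = (\<integral>x. g x \<partial>pullback_limit s)"
        unfolding g_def by (rule measure_transition_operator[OF st pullback_limit_prob A])
      \<comment> \<open>One error comes from the limit at \<open>t\<close>, tested on a set, and two
        from the limit at \<open>s\<close>, tested on the function \<open>g\<close>.\<close>
      ultimately have "\<bar>measure (transition_operator P s t (pullback_limit s)) A - measure (pullback_limit t) A\<bar>
          \<le> 3 * (cauchy_const * \<alpha> powr real n)"
        by linarith
      then show "\<bar>measure (transition_operator P s t (pullback_limit s)) A - measure (pullback_limit t) A\<bar>
          \<le> (3 * cauchy_const) * \<alpha> ^ n"
        using \<alpha> by (simp add: powr_realpow)
    qed
  qed
qed (rule pullback_limit_prob)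

text \<open>At time \<open>\<tau>\<close> both families are images of their members at
  \<open>\<tau> - n\<close>. The finite supremum gives a moment bound \<open>b\<close> independent
  of \<open>n\<close>, so the geometric decay forces equality.\<close>

lemma invariant_family_unique:
  assumes \<nu>: "invariant_measure_family P \<nu>" and fin: "(SUP t. \<integral>\<^sup>+x. V x \<partial>\<nu> t) < \<infinity>"
  shows "\<nu> = pullback_limit"
proof
  fix \<tau>
  obtain b where b: "b \<ge> 0" "(SUP t. \<integral>\<^sup>+x. V x \<partial>\<nu> t) = ennreal b"
    using fin by (cases "SUP t. \<integral>\<^sup>+x. V x \<partial>\<nu> t" rule: ennreal_cases) auto
  have Vb: "(\<integral>\<^sup>+x. V x \<partial>\<nu> t) \<le> ennreal b" for t
    unfolding b(2)[symmetric] by (rule SUP_upper) simp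
  have p: "\<nu> t \<in> space (prob_algebra borel)" for t
    using \<nu> unfolding invariant_measure_family_def by blast
  show "\<nu> \<tau> = pullback_limit \<tau>"
  proof (rule prob_algebra_eqI[OF p pullback_limit_prob])
    fix A :: "'a set" assume A: "A \<in> sets borel"
    show "measure (\<nu> \<tau>) A = measure (pullback_limit \<tau>) A"
    proof (rule eq_if_diff_le_geometric[OF \<alpha>])
      fix n
      have "\<bar>(\<integral>x. indicator A x \<partial>transition_operator P (\<tau> - real n) \<tau> (\<nu> (\<tau> - real n))) -
          (\<integral>x. indicator A x \<partial>transition_operator P (\<tau> - real n) \<tau> (pullback_limit (\<tau> - real n)))\<bar>
        \<le> M * \<alpha> powr (\<tau> - (\<tau> - real n)) * 1 * (2 + \<beta> * (b + moment))"
        using A moment_pos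
        by (intro transition_operator_diff_le p Vb b(1) pullback_limit_prob pullback_limit_moment weighted_osc_le_unit)
          (auto simp: indicator_def bounded_iff intro!: exI[of _ 1])
      moreover have "transition_operator P (\<tau> - real n) \<tau> (\<nu> (\<tau> - real n)) = \<nu> \<tau>"
        "transition_operator P (\<tau> - real n) \<tau> (pullback_limit (\<tau> - real n)) = pullback_limit \<tau>"
        using \<nu> invariant_pullback_limit unfolding invariant_measure_family_def by auto
      ultimately show "\<bar>measure (\<nu> \<tau>) A - measure (pullback_limit \<tau>) A\<bar>
          \<le> (M * (2 + \<beta> * (b + moment))) * \<alpha> ^ n"
        using \<alpha> by (simp add: prob_algebraD(3)[OF p] prob_algebraD(3)[OF pullback_limit_prob] powr_realpow mult_ac)
    qed
  qed
qed

section \<open>Rates of convergence to the invariant family\<close>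

definition rate_const :: real where
  "rate_const = M * (2 + \<beta> * (1 + moment))"

lemma rate_const_pos: "rate_const > 0"
  using M \<beta> moment_pos by (auto simp: rate_const_def intro!: mult_pos_pos add_pos_pos)

text \<open>By invariance the limit at \<open>\<tau>\<close> has itself evolved from time
  \<open>\<tau> - t\<close>, so this compares a point mass with the invariant law at that earlier
  time.\<close>

lemma P_pullback_limit_diff_le:
  assumes t: "t \<ge> 0" and x: "V x < \<infinity>"
    and f: "f \<in> borel_measurable borel" "bounded (range f)" and L: "L \<ge> 0" "weighted_osc_le V \<beta> L f"
  shows "\<bar>(\<integral>y. f y \<partial>P (\<tau> - t) x \<tau>) - (\<integral>y. f y \<partial>pullback_limit \<tau>)\<bar>
    \<le> rate_const * \<alpha> powr t * L * (1 + v x)"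
proof -
  have "transition_operator P (\<tau> - t) \<tau> (pullback_limit (\<tau> - t)) = pullback_limit \<tau>"
    using t invariant_pullback_limit unfolding invariant_measure_family_def by auto
  then have "\<bar>(\<integral>y. f y \<partial>P (\<tau> - t) x \<tau>) - (\<integral>y. f y \<partial>pullback_limit \<tau>)\<bar>
      \<le> M * \<alpha> powr t * L * (2 + \<beta> * (v x + moment))"
    using P_diff_le[OF _ x pullback_limit_prob pullback_limit_moment _ f L, of "\<tau> - t" \<tau> "\<tau> - t"]
      t moment_pos by simp
  \<comment> \<open>The moment is absorbed into the factor \<open>1 + v x\<close>; this determines
    \<open>rate_const\<close>.\<close>
  also have "\<dots> \<le> M * \<alpha> powr t * L * ((2 + \<beta> * (1 + moment)) * (1 + v x))"
  proof (rule mult_left_mono)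
    have "0 \<le> (2 + \<beta> * moment) * v x" using \<beta> moment_pos by simp
    then show "2 + \<beta> * (v x + moment) \<le> (2 + \<beta> * (1 + moment)) * (1 + v x)"
      using \<beta> by (simp add: algebra_simps)
  qed (use M L in auto)
  finally show ?thesis by (simp add: rate_const_def mult_ac)
qed

lemma tv_norm_diff_P_pullback_limit_le:
  assumes t: "t \<ge> 0"
  shows "tv_norm_diff (P (\<tau> - t) x \<tau>) (pullback_limit \<tau>) \<le> ennreal (rate_const * \<alpha> powr t) * (1 + V x)"
proof (cases "V x < \<infinity>")
  \<comment> \<open>The right-hand side is infinite, its constant being positive.\<close>
  case False
  then show ?thesis
    using rate_const_pos \<alpha> by (simp add: ennreal_mult_top less_top[symmetric])
next
  case True
  have "tv_norm_diff (P (\<tau> - t) x \<tau>) (pullback_limit \<tau>) \<le> ennreal (rate_const * \<alpha> powr t * 1 * (1 + v x))"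
    using t True
    by (intro tv_norm_diff_leI P_pullback_limit_diff_le weighted_osc_le_unit) (auto simp: bounded_iff)
  also have "\<dots> = ennreal (rate_const * \<alpha> powr t) * (1 + ennreal (v x))"
    using rate_const_pos by (simp add: ennreal_mult' flip: ennreal_1 ennreal_plus)
  also have "ennreal (v x) = V x" using True by simp
  finally show ?thesis .
qed

text \<open>Subtracting a constant does not change the oscillation, so the norm may be taken after
  any centring. The factor \<open>max 1 (1 / \<beta>)\<close> passes from the weight
  \<open>1 + V\<close> to \<open>1 + \<beta> * V\<close>.\<close>

lemma weighted_osc_le_of_weighted_sup_norm:
  assumes n: "weighted_sup_norm V (\<lambda>x. f x - c) \<le> ennreal n" "n \<ge> 0"
  shows "weighted_osc_le V \<beta> (n * max 1 (1 / \<beta>)) f"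
  unfolding weighted_osc_le_def
proof (intro allI impI)
  have pt: "\<bar>f x - c\<bar> \<le> n * (1 + v x)" if x: "V x < \<infinity>" for x
  proof -
    have "ennreal \<bar>f x - c\<bar> / (1 + ennreal (v x)) \<le> ennreal n"
      using x by (intro order_trans[OF _ n(1)]) (auto simp: weighted_sup_norm_def intro!: SUP_upper2[of x])
    moreover have pos: "1 + v x > 0" by (simp add: add_pos_nonneg)
    moreover have "1 + ennreal (v x) = ennreal (1 + v x)" by (simp flip: ennreal_1 ennreal_plus)
    ultimately have "ennreal (\<bar>f x - c\<bar> / (1 + v x)) \<le> ennreal n"
      by (simp only: divide_ennreal abs_ge_zero)
    then have "\<bar>f x - c\<bar> / (1 + v x) \<le> n"
      using n(2) by (simp only: ennreal_le_iff)
    then show ?thesis using pos by (simp add: field_simps)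
  qed
  fix x y assume xy: "V x < \<infinity>" "V y < \<infinity>"
  define b where "b = max 1 (1 / \<beta>)"
  have b: "b \<ge> 1" "b * \<beta> \<ge> 1" using \<beta> by (auto simp: b_def max_def field_simps)
  have "\<bar>f x - f y\<bar> \<le> n * (2 + (v x + v y))"
    using pt[OF xy(1)] pt[OF xy(2)] by (simp add: algebra_simps)
  also have "\<dots> \<le> n * (b * 2 + (b * \<beta>) * (v x + v y))"
    using b n(2) mult_right_mono[OF b(2), of "v x + v y"] by (intro mult_left_mono add_mono) auto
  finally show "\<bar>f x - f y\<bar> \<le> n * max 1 (1 / \<beta>) * (2 + \<beta> * (v x + v y))"
    by (simp add: b_def algebra_simps)
qed

lemma weighted_sup_norm_P_pullback_limit_le:
  assumes t: "t \<ge> 0" and f: "f \<in> borel_measurable borel" "bounded (range f)"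
  shows "weighted_sup_norm V (\<lambda>x. (\<integral>y. f y \<partial>P (\<tau> - t) x \<tau>) - (\<integral>y. f y \<partial>pullback_limit \<tau>))
    \<le> ennreal (rate_const * max 1 (1 / \<beta>) * \<alpha> powr t) *
      weighted_sup_norm V (\<lambda>x. f x - (\<integral>y. f y \<partial>pullback_limit \<tau>))"
proof -
  define c where "c = (\<integral>y. f y \<partial>pullback_limit \<tau>)"
  define b where "b = max 1 (1 / \<beta>)"
  have b: "b > 0" by (simp add: b_def)
  define r where "r = rate_const * b * \<alpha> powr t"
  have r: "r > 0" using rate_const_pos b \<alpha> by (simp add: r_def)
  show ?thesis
  proof (cases "weighted_sup_norm V (\<lambda>x. f x - c)" rule: ennreal_cases)
    \<comment> \<open>With \<open>r > 0\<close> the right-hand side is infinite.\<close>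
    case top
    then show ?thesis
      using r unfolding r_def[symmetric] b_def[symmetric] c_def[symmetric]
      by (simp add: ennreal_mult_top)
  next
    case (real n)
    have "ennreal \<bar>(\<integral>y. f y \<partial>P (\<tau> - t) x \<tau>) - c\<bar> / (1 + V x) \<le> ennreal (r * n)" for x
    proof (cases "V x < \<infinity>")
      \<comment> \<open>An infinite denominator makes the quotient \<open>0\<close>.\<close>
      case False
      then show ?thesis by (simp add: less_top[symmetric])
    next
      case True
      have pos: "1 + v x > 0" by (simp add: add_pos_nonneg)
      have "\<bar>(\<integral>y. f y \<partial>P (\<tau> - t) x \<tau>) - c\<bar> \<le> rate_const * \<alpha> powr t * (n * b) * (1 + v x)"
        unfolding c_def using real b
        by (intro P_pullback_limit_diff_le t True f weighted_osc_le_of_weighted_sup_norm[where c = c, folded b_def]) auto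
      then have "\<bar>(\<integral>y. f y \<partial>P (\<tau> - t) x \<tau>) - c\<bar> / (1 + v x) \<le> r * n"
        using pos by (simp add: r_def field_simps)
      moreover have "ennreal (1 + v x) = 1 + V x" using True by simp
      ultimately show ?thesis
        using divide_ennreal[OF abs_ge_zero pos, of "(\<integral>y. f y \<partial>P (\<tau> - t) x \<tau>) - c"]
        by (simp add: ennreal_leI)
    qed
    then have "weighted_sup_norm V (\<lambda>x. (\<integral>y. f y \<partial>P (\<tau> - t) x \<tau>) - c) \<le> ennreal (r * n)"
      unfolding weighted_sup_norm_def by (rule SUP_least)
    then show ?thesis
      using real r by (simp add: r_def b_def c_def ennreal_mult)
  qed
qed

end

theorem theorem3p18:
  fixes P :: "real \<Rightarrow> 'a::polish_space \<Rightarrow> real \<Rightarrow> 'a measure"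
    and V :: "'a \<Rightarrow> ennreal"
  assumes "transition_probabilities P"
    and "V \<in> borel_measurable borel"
    and A1: "lyapunov_condition P V"
    and A2: "local_doeblin_condition P V"
  shows "\<exists>\<mu>. invariant_measure_family P \<mu> \<and>
      (\<forall>t. (\<integral>\<^sup>+ x. V x \<partial>\<mu> t) < \<infinity>) \<and>
      (SUP t. \<integral>\<^sup>+ x. V x \<partial>\<mu> t) < \<infinity> \<and>
      (\<forall>\<nu>. invariant_measure_family P \<nu> \<and> (SUP t. \<integral>\<^sup>+ x. V x \<partial>\<nu> t) < \<infinity> \<longrightarrow> \<nu> = \<mu>) \<and>
      (\<exists>\<alpha> M::real. 0 < \<alpha> \<and> \<alpha> < 1 \<and> M > 0 \<and>
        (\<forall>\<tau> t. \<forall>\<phi>::'a \<Rightarrow> real. t \<ge> 0 \<and> \<phi> \<in> borel_measurable borel \<and> bounded (range \<phi>) \<longrightarrow>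
          weighted_sup_norm V (\<lambda>x. (\<integral>y. \<phi> y \<partial>P (\<tau> - t) x \<tau>) - (\<integral>y. \<phi> y \<partial>\<mu> \<tau>))
          \<le> ennreal (M * \<alpha> powr t) * weighted_sup_norm V (\<lambda>x. \<phi> x - (\<integral>y. \<phi> y \<partial>\<mu> \<tau>)))) \<and>
      (\<exists>\<alpha> M::real. 0 < \<alpha> \<and> \<alpha> < 1 \<and> M > 0 \<and>
        (\<forall>\<tau> t x. t \<ge> 0 \<longrightarrow>
          tv_norm_diff (P (\<tau> - t) x \<tau>) (\<mu> \<tau>) \<le> ennreal (M * \<alpha> powr t) * (1 + V x)))"
proof -
  interpret harris_transition P V
    using assms by unfold_locales
  \<comment> \<open>The constants produced by the contraction argument become the parameters for the
    construction of the invariant family.\<close>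
  obtain K \<beta> \<alpha> M where "weighted_decay P V K \<beta> \<alpha> M"
  proof (rule weighted_osc_P_decay)
    fix K \<beta> \<alpha> M :: real
    assume *: "K > 0" "\<beta> > 0" "0 < \<alpha>" "\<alpha> < 1" "M > 0"
      "\<And>x s t. s \<le> t \<Longrightarrow> V x < \<infinity> \<Longrightarrow> (\<integral>\<^sup>+y. V y \<partial>P s x t) \<le> ennreal (v x + K)"
      "\<And>s t f L. s \<le> t \<Longrightarrow> f \<in> borel_measurable borel \<Longrightarrow> bounded (range f) \<Longrightarrow> L \<ge> 0 \<Longrightarrow>
        weighted_osc_le V \<beta> L f \<Longrightarrow> weighted_osc_le V \<beta> (M * \<alpha> powr (t - s) * L) (\<lambda>x. \<integral>y. f y \<partial>P s x t)"
    have "weighted_decay P V K \<beta> \<alpha> M"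
      by unfold_locales (fact V finite_point *)+
    then show thesis by (rule that)
  qed
  then interpret D: weighted_decay P V K \<beta> \<alpha> M .
  have sup: "(SUP t. \<integral>\<^sup>+x. V x \<partial>D.pullback_limit t) \<le> ennreal D.moment"
    by (intro SUP_least D.pullback_limit_moment)
  show ?thesis
  proof (intro exI[of _ D.pullback_limit] conjI allI impI)
    show "(\<integral>\<^sup>+x. V x \<partial>D.pullback_limit t) < \<infinity>" for t
      using D.pullback_limit_moment[of t] by (rule le_less_trans) simp
    show "(SUP t. \<integral>\<^sup>+x. V x \<partial>D.pullback_limit t) < \<infinity>"
      using sup by (rule le_less_trans) simp
    \<comment> \<open>Both rates share the same \<open>\<alpha>\<close>; changing between the two
      weights affects only the constant in front.\<close>
    have "D.rate_const * max 1 (1 / \<beta>) > 0" using D.rate_const_pos by simp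
    then show "\<exists>\<alpha> M::real. 0 < \<alpha> \<and> \<alpha> < 1 \<and> M > 0 \<and>
      (\<forall>\<tau> t. \<forall>\<phi>::'a \<Rightarrow> real. t \<ge> 0 \<and> \<phi> \<in> borel_measurable borel \<and> bounded (range \<phi>) \<longrightarrow>
        weighted_sup_norm V (\<lambda>x. (\<integral>y. \<phi> y \<partial>P (\<tau> - t) x \<tau>) - (\<integral>y. \<phi> y \<partial>D.pullback_limit \<tau>))
        \<le> ennreal (M * \<alpha> powr t) * weighted_sup_norm V (\<lambda>x. \<phi> x - (\<integral>y. \<phi> y \<partial>D.pullback_limit \<tau>)))"
      using D.\<alpha> D.weighted_sup_norm_P_pullback_limit_le by blast
    show "\<exists>\<alpha> M::real. 0 < \<alpha> \<and> \<alpha> < 1 \<and> M > 0 \<and>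
      (\<forall>\<tau> t x. t \<ge> 0 \<longrightarrow>
        tv_norm_diff (P (\<tau> - t) x \<tau>) (D.pullback_limit \<tau>) \<le> ennreal (M * \<alpha> powr t) * (1 + V x))"
      using D.\<alpha> D.rate_const_pos D.tv_norm_diff_P_pullback_limit_le by blast
    show "\<nu> = D.pullback_limit"
      if "invariant_measure_family P \<nu> \<and> (SUP t. \<integral>\<^sup>+x. V x \<partial>\<nu> t) < \<infinity>" for \<nu>
      using that by (intro D.invariant_family_unique) auto
  qed (rule D.invariant_pullback_limit)
qed

end
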